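(* Consider the full-rank macro--micro scheme (defined in the context). For given spatial grid sizes $\Delta x,\Delta y$, let the step size $\Delta t$ satisfy the following CFL condition for all $\Omega_x^\ell,\Omega_y^\ell\ne0$: $$\Delta t\le\frac1{3c}\min\left\{\varepsilon\Delta x+\frac{\sigma^t_0\Delta x^2}{4|\Omega_x^\ell|},\ \varepsilon\Delta y+\frac{\sigma^t_0\Delta y^2}{4|\Omega_y^\ell|}\right\}.$$ Then the full-rank macro--micro scheme is energy stable, i.e. $e^{n+1}\le e^n$, where the energy at time $t_n$ is $$e^n:=\left\|\frac1cB^n+\frac{\varepsilon^2}{c}h^n\right\|^2+\frac1{2\pi}\left\|\frac{\varepsilon}{c}\mathbf{g}^n\right\|_\Omega^2+\frac25\left\|\frac{\sqrt{ac_\nu}}{2\pi}(T^n)^{5/2}\right\|^2 .$$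
   Context: Constants: $\varepsilon$ (Knudsen number), $c$ (speed of light), $a$ (radiation constant), $c_\nu$ (specific heat), step size $\Delta t$, grid sizes $\Delta x,\Delta y$. The absorption and scattering cross sections $\sigma^a,\sigma^s$ depend on position $\mathbf{x}$, with $\sigma^a(\mathbf{x})\ge\sigma^a_0>0$ and $\sigma^t(\mathbf{x})=\sigma^a(\mathbf{x})+\sigma^s(\mathbf{x})\ge\sigma^t_0>0$; subscripts denote values at grid points. Staggered grid: a rectangle $[x_L,x_R]\times[y_B,y_T]$ is discretized with equidistant points $x_i$ (cell midpoints) and $x_{i+1/2}$ (cell interfaces) of spacing $\Delta x$, and $y_j$, $y_{j+1/2}$ of spacing $\Delta y$. $\mathcal{K}^{C}$ is the set of indices of the form $(i,j)$ (cell centers) or $(i+\frac12,j+\frac12)$ (cell corners); $\mathcal{K}^{I}$ is the set of indices of the form $(i+\frac12,j)$ or $(i,j+\frac12)$ (interfaces). The scalars $T_\kappa$ (material temperature) and $h_\kappa$ live on $\kappa\in\mathcal{K}^C$; the vectors $g_\kappa=(g_{\kappa,1},\dots,g_{\kappa,N_q})^\top\in\mathbb{R}^{N_q}$ live on $\kappa\in\mathcal{K}^I$ and satisfy the zero-mean condition $w^\top g_\kappa=0$ of the macro--micro decomposition $f=B(T)+\varepsilon g+\varepsilon^2h$ of the particle density $f$. $B^n_\kappa:=\frac{ac}{2\pi}(T^n_\kappa)^4$ (Stefan--Boltzmann law). The statement names no particular boundary condition. Angular discretization: tensorized Gauss--Legendre (product) quadrature with nodes $(\Omega_x^\ell,\Omega_y^\ell)$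 and weights $w^\ell=w_\ell$, $\ell=1,\dots,N_q$, on $\{(\sqrt{1-\mu^2}\sin\theta,\sqrt{1-\mu^2}\cos\theta):0\le\mu\le1,\ 0\le\theta\le2\pi\}$, the projection of the unit sphere onto the plane; $w=(w^1,\dots,w^{N_q})^\top$, $\mathbb{1}=(1,\dots,1)^\top$, $I$ the identity matrix, $Q_v=\mathrm{diag}(\Omega_v^1,\dots,\Omega_v^{N_q})$, $|Q_v|=\mathrm{diag}(|\Omega_v^1|,\dots,|\Omega_v^{N_q}|)$, $Q_v^\pm=(Q_v\pm|Q_v|)/2$ for $v\in\{x,y\}$. By the choice of quadrature, $w^\top Q_xQ_x\mathbb{1}=w^\top Q_yQ_y\mathbb{1}=2\pi/3$ and $w^\top Q_xQ_y\mathbb{1}=0$. Norms: with $\Delta\zeta=\Delta x\Delta y$, $\|u\|^2=\sum_{\kappa\in\mathcal{K}^C}u_\kappa^2\,\Delta\zeta$ for grid functions $u$ on $\mathcal{K}^C$ (powers such as $T^{5/2}$ are taken pointwise), and $\|\mathbf{g}\|_\Omega^2=\sum_{\kappa\in\mathcal{K}^I}\sum_{\ell=1}^{N_q}w_\ell g_{\kappa,\ell}^2\,\Delta\zeta$. Difference operators: for $(\alpha,\beta)\in\mathcal{K}^I$, $\mathcal{D}^+_xg_{\alpha\beta}=\frac{g_{\alpha+1,\beta}-g_{\alpha\beta}}{\Delta x}$, $\mathcal{D}^-_xg_{\alpha\beta}=\frac{g_{\alpha\beta}-g_{\alpha-1,\beta}}{\Delta x}$, $\delta^0_xh_{\alpha\beta}=\frac{h_{\alpha+1/2,\beta}-h_{\alpha-1/2,\beta}}{\Delta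 x}$; for $(\alpha,\beta)\in\mathcal{K}^C$, $\mathcal{D}^0_xg_{\alpha\beta}=\frac{g_{\alpha+1/2,\beta}-g_{\alpha-1/2,\beta}}{\Delta x}$; the operators in $y$ are analogous. $\mathcal{L}_v=Q_v^-\mathcal{D}_v^++Q_v^+\mathcal{D}_v^-$. Full-rank macro--micro scheme: from time $t_n$ to $t_{n+1}=t_n+\Delta t$, for $\kappa\in\mathcal{K}^I$, $$\frac{\varepsilon^2}{c\Delta t}(g^{n+1}_\kappa-g^n_\kappa)+\varepsilon\Big(I-\frac1{2\pi}\mathbb{1}w^\top\Big)(\mathcal{L}_x+\mathcal{L}_y)g^n_\kappa+\sum_{v\in\{x,y\}}Q_v\mathbb{1}\,\delta^0_v(B^n_\kappa+\varepsilon^2h^n_\kappa)=-\sigma^t_\kappa g^{n+1}_\kappa,$$ and for $\kappa\in\mathcal{K}^C$, $$\frac{\varepsilon^2}{c\Delta t}(h^{n+1}_\kappa-h^n_\kappa)+\frac1{c\Delta t}(B^{n+1}_\kappa-B^n_\kappa)+\frac1{2\pi}\sum_{v\in\{x,y\}}w^\top Q_v\mathcal{D}^0_vg^{n+1}_\kappa=-\sigma^a_\kappa h^{n+1}_\kappa,$$ $$\frac{c_\nu}{\Delta t}(T^{n+1}_\kappa-T^n_\kappa)=2\pi\sigma^a_\kappa h^{n+1}_\kappa.$$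
   Formalization: The statement names no boundary condition, and inflow data can raise the energy; the formal theorem assumes all fields are periodic or vanish on and outside the boundary of the rectangle. It also assumes T ≥ 0 at both time levels, so that T^{5/2} is real. *)

theory Defs
  imports "HOL-Analysis.Analysis" "HOL-Computational_Algebra.Polynomial"
begin

section \<open>Staggered grid\<close>

datatype axis = Xdir | Ydir

text \<open>
  Grid indices are stored doubled: \<open>(p, q)\<close> stands for the index \<open>(p/2, q/2)\<close>.
  Even coordinates are cell midpoints and odd coordinates are cell interfaces; a shift by
  \<open>unit_step v\<close> is a half step and two such shifts are a full step in direction \<open>v\<close>.
\<close>

type_synonym index = "int \<times> int"

fun unit_step :: "axis \<Rightarrow> index" where
  "unit_step Xdir = (1, 0)"
| "unit_step Ydir = (0, 1)"

definition centers :: "index set"  \<comment> \<open>\<open>(i, j)\<close> and \<open>(i + 1/2, j + 1/2)\<close>\<close>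
  where "centers = {(p, q). even (p + q)}"

definition interfaces :: "index set"  \<comment> \<open>\<open>(i + 1/2, j)\<close> and \<open>(i, j + 1/2)\<close>\<close>
  where "interfaces = {(p, q). odd (p + q)}"

text \<open>
  Position of a grid point; \<open>lo\<close> is the lower left corner of the rectangle and has the doubled
  index \<open>(1, 1)\<close>, i.e. it is the interface \<open>(1/2, 1/2)\<close>. With \<open>N v\<close> cells in direction \<open>v\<close>, the
  upper right corner has the doubled index \<open>(2 N Xdir + 1, 2 N Ydir + 1)\<close>.
\<close>

definition position :: "(axis \<Rightarrow> real) \<Rightarrow> (axis \<Rightarrow> real) \<Rightarrow> index \<Rightarrow> real \<times> real" where
  "position lo \<Delta> = (\<lambda>(p, q). (lo Xdir + (real_of_int p - 1) / 2 * \<Delta> Xdir,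
                               lo Ydir + (real_of_int q - 1) / 2 * \<Delta> Ydir))"

text \<open>
  Boundary conditions: periodic, or homogeneous Dirichlet (all fields vanish on the boundary of
  the rectangle and outside of it).
\<close>

datatype bc = Periodic | Zero_Dirichlet

text \<open>
  The grid points that carry unknowns: one period (opposite sides of the rectangle are
  identified), or the points in the open rectangle. In the Dirichlet case the boundary points
  carry the value zero and do not contribute to any norm.
\<close>

fun unknowns :: "bc \<Rightarrow> (axis \<Rightarrow> nat) \<Rightarrow> index set" where
  "unknowns Periodic N = {1..2 * int (N Xdir)} \<times> {1..2 * int (N Ydir)}"
| "unknowns Zero_Dirichlet N = {2..2 * int (N Xdir)} \<times> {2..2 * int (N Ydir)}"

fun satisfies_bc :: "bc \<Rightarrow> (axis \<Rightarrow> nat) \<Rightarrow> index set \<Rightarrow> (index \<Rightarrow> 'a::zero) \<Rightarrow> bool" where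
  "satisfies_bc Periodic N K u \<longleftrightarrow>
     (\<forall>(p, q)\<in>K. u (p + 2 * int (N Xdir), q) = u (p, q) \<and> u (p, q + 2 * int (N Ydir)) = u (p, q))"
| "satisfies_bc Zero_Dirichlet N K u \<longleftrightarrow> (\<forall>\<kappa>\<in>K - unknowns Zero_Dirichlet N. u \<kappa> = 0)"


section \<open>Difference operators\<close>

definition diff_fwd :: "(axis \<Rightarrow> real) \<Rightarrow> axis \<Rightarrow> (index \<Rightarrow> 'a::real_vector) \<Rightarrow> index \<Rightarrow> 'a" where
  "diff_fwd \<Delta> v u \<kappa> = (u (\<kappa> + unit_step v + unit_step v) - u \<kappa>) /\<^sub>R \<Delta> v"

definition diff_bwd :: "(axis \<Rightarrow> real) \<Rightarrow> axis \<Rightarrow> (index \<Rightarrow> 'a::real_vector) \<Rightarrow> index \<Rightarrow> 'a" where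
  "diff_bwd \<Delta> v u \<kappa> = (u \<kappa> - u (\<kappa> - unit_step v - unit_step v)) /\<^sub>R \<Delta> v"

text \<open>
  The staggered central difference. It is \<open>\<delta>\<^sup>0\<close> at interfaces (acting on fields that live on
  \<open>centers\<close>) and \<open>\<D>\<^sup>0\<close> at centers (acting on fields that live on \<open>interfaces\<close>).
\<close>

definition diff_ctr :: "(axis \<Rightarrow> real) \<Rightarrow> axis \<Rightarrow> (index \<Rightarrow> 'a::real_vector) \<Rightarrow> index \<Rightarrow> 'a" where
  "diff_ctr \<Delta> v u \<kappa> = (u (\<kappa> + unit_step v) - u (\<kappa> - unit_step v)) /\<^sub>R \<Delta> v"


section \<open>Angular discretization\<close>

definition diag_mat :: "real^'q \<Rightarrow> real^'q^'q" where
  "diag_mat d = (\<chi> i j. if i = j then d $ i else 0)"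

definition Q :: "(axis \<Rightarrow> real^'q) \<Rightarrow> axis \<Rightarrow> real^'q^'q" where
  "Q \<Omega> v = diag_mat (\<Omega> v)"

definition Q_abs :: "(axis \<Rightarrow> real^'q) \<Rightarrow> axis \<Rightarrow> real^'q^'q" where
  "Q_abs \<Omega> v = diag_mat (\<chi> l. \<bar>\<Omega> v $ l\<bar>)"

definition Q_plus :: "(axis \<Rightarrow> real^'q) \<Rightarrow> axis \<Rightarrow> real^'q^'q" where
  "Q_plus \<Omega> v = (1 / 2) *\<^sub>R (Q \<Omega> v + Q_abs \<Omega> v)"

definition Q_minus :: "(axis \<Rightarrow> real^'q) \<Rightarrow> axis \<Rightarrow> real^'q^'q" where
  "Q_minus \<Omega> v = (1 / 2) *\<^sub>R (Q \<Omega> v - Q_abs \<Omega> v)"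

definition upwind ::
  "(axis \<Rightarrow> real) \<Rightarrow> (axis \<Rightarrow> real^'q) \<Rightarrow> axis \<Rightarrow> (index \<Rightarrow> real^'q) \<Rightarrow> index \<Rightarrow> real^'q" where
  "upwind \<Delta> \<Omega> v g \<kappa> = Q_minus \<Omega> v *v diff_fwd \<Delta> v g \<kappa> + Q_plus \<Omega> v *v diff_bwd \<Delta> v g \<kappa>"

text \<open>\<open>I - 1 w\<^sup>T / (2 \<pi>)\<close>; the vector \<open>1 :: real^'q\<close> is the all-ones vector.\<close>

definition micro_proj :: "real^'q \<Rightarrow> real^'q^'q" where
  "micro_proj w = mat 1 - (1 / (2 * pi)) *\<^sub>R ((columnvector 1 :: real^1^'q) ** rowvector w)"

text \<open>Gauss-Legendre rule on \<open>[a, b]\<close> with \<open>CARD('p)\<close> nodes.\<close>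

definition gauss_legendre :: "real \<Rightarrow> real \<Rightarrow> ('p::finite \<Rightarrow> real) \<Rightarrow> ('p \<Rightarrow> real) \<Rightarrow> bool" where
  "gauss_legendre a b x \<omega> \<longleftrightarrow> inj x \<and> range x \<subseteq> {a..b} \<and>
     (\<forall>p::real poly. degree p \<le> 2 * CARD('p) - 1 \<longrightarrow>
        (\<Sum>k\<in>UNIV. \<omega> k * poly p (x k)) = integral {a..b} (poly p))"

text \<open>
  Both common conventions for the polar variable \<open>0 \<le> \<mu> \<le> 1\<close>: the Gauss-Legendre rule on
  \<open>[0, 1]\<close>, or the nonnegative half of the Gauss-Legendre rule on \<open>[-1, 1]\<close> with an even number of
  nodes (the nodes of that rule come in pairs \<open>\<plusminus>\<mu>\<close> of equal weight).
\<close>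

definition polar_rule :: "('p::finite \<Rightarrow> real) \<Rightarrow> ('p \<Rightarrow> real) \<Rightarrow> bool" where
  "polar_rule \<mu> \<omega> \<longleftrightarrow>
     gauss_legendre 0 1 \<mu> \<omega> \<or>
     range \<mu> \<subseteq> {0..1} \<and>
     gauss_legendre (- 1) 1 (\<lambda>(k, s). if s then \<mu> k else - \<mu> k) (\<lambda>(k, s::bool). \<omega> k)"

text \<open>
  Product quadrature on the half sphere \<open>\<mu> \<ge> 0\<close>, projected onto the plane, with
  \<open>N\<^sub>q = CARD('p) * CARD('r)\<close> nodes. The azimuthal rule is any positive rule on \<open>[0, 2\<pi>]\<close> of total
  mass \<open>2\<pi>\<close> for which the second moments of the product rule are exact, e.g. three or more
  equispaced nodes with equal weights.
\<close>

definition tensor_gauss_legendre ::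
  "real^('p::finite \<times> 'r::finite) \<Rightarrow> (axis \<Rightarrow> real^('p \<times> 'r)) \<Rightarrow> bool" where
  "tensor_gauss_legendre w \<Omega> \<longleftrightarrow>
     (\<exists>(\<mu> :: 'p \<Rightarrow> real) \<omega> (\<theta> :: 'r \<Rightarrow> real) \<eta>.
        polar_rule \<mu> \<omega> \<and>
        (\<forall>m. \<theta> m \<in> {0..2 * pi} \<and> \<eta> m > 0) \<and> (\<Sum>m\<in>UNIV. \<eta> m) = 2 * pi \<and>
        (\<forall>k m. w $ (k, m) = \<omega> k * \<eta> m \<and>
               \<Omega> Xdir $ (k, m) = sqrt (1 - (\<mu> k)\<^sup>2) * sin (\<theta> m) \<and>
               \<Omega> Ydir $ (k, m) = sqrt (1 - (\<mu> k)\<^sup>2) * cos (\<theta> m))) \<and>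
     w \<bullet> ((Q \<Omega> Xdir ** Q \<Omega> Xdir) *v 1) = 2 * pi / 3 \<and>
     w \<bullet> ((Q \<Omega> Ydir ** Q \<Omega> Ydir) *v 1) = 2 * pi / 3 \<and>
     w \<bullet> ((Q \<Omega> Xdir ** Q \<Omega> Ydir) *v 1) = 0"


section \<open>Norms and energy\<close>

definition planck :: "real \<Rightarrow> real \<Rightarrow> (index \<Rightarrow> real) \<Rightarrow> index \<Rightarrow> real" where
  "planck a c T \<kappa> = a * c / (2 * pi) * (T \<kappa>) ^ 4"

text \<open>The two squared norms; \<open>D\<close> is the finite set of grid points of the rectangle.\<close>

definition sqnorm_C :: "(axis \<Rightarrow> real) \<Rightarrow> index set \<Rightarrow> (index \<Rightarrow> real) \<Rightarrow> real" where
  "sqnorm_C \<Delta> D u = (\<Sum>\<kappa>\<in>centers \<inter> D. (u \<kappa>)\<^sup>2 * (\<Delta> Xdir * \<Delta> Ydir))"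

definition sqnorm_I ::
  "(axis \<Rightarrow> real) \<Rightarrow> index set \<Rightarrow> real^'q \<Rightarrow> (index \<Rightarrow> real^'q) \<Rightarrow> real" where
  "sqnorm_I \<Delta> D w g =
     (\<Sum>\<kappa>\<in>interfaces \<inter> D. \<Sum>l\<in>UNIV. w $ l * (g \<kappa> $ l)\<^sup>2 * (\<Delta> Xdir * \<Delta> Ydir))"

definition energy ::
  "real \<Rightarrow> real \<Rightarrow> real \<Rightarrow> real \<Rightarrow> (axis \<Rightarrow> real) \<Rightarrow> index set \<Rightarrow> real^'q \<Rightarrow>
   (index \<Rightarrow> real^'q) \<Rightarrow> (index \<Rightarrow> real) \<Rightarrow> (index \<Rightarrow> real) \<Rightarrow> real" where
  "energy \<epsilon> c a c\<^sub>\<nu> \<Delta> D w g h T =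
     sqnorm_C \<Delta> D (\<lambda>\<kappa>. 1 / c * planck a c T \<kappa> + \<epsilon>\<^sup>2 / c * h \<kappa>)
     + 1 / (2 * pi) * sqnorm_I \<Delta> D w (\<lambda>\<kappa>. (\<epsilon> / c) *\<^sub>R g \<kappa>)
     + 2 / 5 * sqnorm_C \<Delta> D (\<lambda>\<kappa>. sqrt (a * c\<^sub>\<nu>) / (2 * pi) * T \<kappa> powr (5 / 2))"

end

theory Submission
  imports Defs
begin

text \<open>
  Why the scheme is stable. Write \<open>u = B + \<epsilon>\<^sup>2 h\<close> and \<open>\<tau> = c \<Delta>t\<close>, and multiply the energy by
  \<open>2 \<pi> c\<^sup>2 / (\<Delta>x \<Delta>y)\<close>. Testing the macroscopic equation with \<open>u\<^sup>n\<^sup>+\<^sup>1\<close> and the microscopic one with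
  \<open>w g\<^sup>n\<^sup>+\<^sup>1\<close> gives one inequality per grid point (\<open>macro_balance\<close>, \<open>micro_balance\<close>). The identity
  \<open>2 x (x - y) = x\<^sup>2 - y\<^sup>2 + (x - y)\<^sup>2\<close> produces the energy increments together with the squared
  increments of \<open>u\<close> and \<open>g\<close>. The absorption term \<open>\<sigma>\<^sup>a h B\<close> is, by the temperature equation, a multiple
  of \<open>T\<^sup>4\<close> times the increment of \<open>T\<close>, which dominates the increment of \<open>T\<^sup>5 / 5\<close> by convexity. The
  projection \<open>I - 1 w\<^sup>T / (2 \<pi>)\<close> disappears because \<open>g\<^sup>n\<^sup>+\<^sup>1\<close> has zero mean.

  Summed over the grid, the discrete gradient of \<open>u\<^sup>n\<close> tested with \<open>g\<^sup>n\<^sup>+\<^sup>1\<close> cancels against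
  \<open>u\<^sup>n\<close> times the discrete divergence of \<open>g\<^sup>n\<^sup>+\<^sup>1\<close>. What is left is explicit: the flux pairs with the
  increment of \<open>u\<close>, and the upwind operator acts on \<open>g\<^sup>n\<close> instead of \<open>g\<^sup>n\<^sup>+\<^sup>1\<close>. Both defects are absorbed
  by the squared increments through Young's inequality, each at the price of \<open>\<tau>\<^sup>2\<close> times
  \<open>\<Sum>\<^sub>l w\<^sub>l \<parallel>\<Omega>\<^sub>x D\<^sub>x g\<^sub>l + \<Omega>\<^sub>y D\<^sub>y g\<^sub>l\<parallel>\<^sup>2\<close> for \<open>g = g\<^sup>n\<^sup>+\<^sup>1\<close> and suitable differences \<open>D\<close>. Since nodes
  lie in the unit disc, \<open>\<bar>\<Omega>\<^sub>x\<bar> + \<bar>\<Omega>\<^sub>y\<bar> \<le> sqrt 2 \<le> 3/2\<close>, and each price is at most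
  \<open>(3/2) \<tau>\<^sup>2 \<Sum>\<^sub>l w\<^sub>l \<Sum>\<^sub>v \<bar>\<Omega>\<^sub>v\<bar> \<parallel>D\<^sub>v g\<^sub>l\<parallel>\<^sup>2\<close>; the two prices together are where the 3 of the CFL
  condition comes from. They are paid, after division by \<open>2 \<tau>\<close>, by the numerical viscosity of upwinding,
  \<open>\<epsilon> \<bar>\<Omega>\<^sub>v\<bar> \<Delta>v \<parallel>D\<^sub>v g\<^sub>l\<parallel>\<^sup>2 / 2\<close>, and by \<open>\<sigma>\<^sup>t \<parallel>g\<^sub>l\<parallel>\<^sup>2\<close>, half of which is used in each direction through the
  inverse inequality \<open>\<Delta>v\<^sup>2 \<parallel>D\<^sub>v g\<^sub>l\<parallel>\<^sup>2 \<le> 4 \<parallel>g\<^sub>l\<parallel>\<^sup>2\<close> (\<open>ordinate_dissipation\<close>, \<open>coupled_dissipation\<close>).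

  Both boundary conditions are reduced to sums over a torus. Periodic fields live on one already. A
  field with zero Dirichlet data is extended periodically with one additional cell in each direction;
  the additional cell separates the copies, so that no stencil centred at an unknown sees the
  neighbouring copy. At a point that carries no unknown every term of the tested equations vanishes,
  so the sums over the torus contain only points where the scheme is imposed.
\<close>

section \<open>Positivity and mass of the quadrature\<close>

text \<open>
  The square of the Lagrange polynomial of a node has degree \<open>2 n - 2\<close>, so the rule integrates it
  exactly; only that node contributes to the sum, and the integral is nonnegative.
\<close>

lemma gauss_legendre_weights:
  fixes x \<omega> :: "'p::finite \<Rightarrow> real"
  assumes gl: "gauss_legendre A B x \<omega>" and AB: "A \<le> B"
  shows "\<omega> k \<ge> 0" "(\<Sum>k\<in>UNIV. \<omega> k) = B - A"
proof -
  have inj: "inj x"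
    and exact: "\<And>p::real poly. degree p \<le> 2 * CARD('p) - 1 \<Longrightarrow>
        (\<Sum>k\<in>UNIV. \<omega> k * poly p (x k)) = integral {A..B} (poly p)"
    using gl unfolding gauss_legendre_def by blast+
  have "(\<Sum>k\<in>UNIV. \<omega> k * poly 1 (x k)) = integral {A..B} (poly 1)"
    by (rule exact) simp
  moreover have "integral {A..B} (poly 1) = integral {A..B} (\<lambda>_. 1 :: real)"
    by (rule integral_cong) simp
  ultimately show "(\<Sum>k\<in>UNIV. \<omega> k) = B - A"
    using AB by simp
  define p where "p = (\<Prod>j\<in>UNIV - {k}. [:- x j, 1:]) ^ 2"
  have deg: "degree (\<Prod>j\<in>UNIV - {k}. [:- x j, 1:]) \<le> CARD('p) - 1"
    using degree_prod_sum_le[of "UNIV - {k}" "\<lambda>j. [:- x j, 1:]"] by (simp add: card_Diff_singleton)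
  have "degree p \<le> (CARD('p) - 1) * 2"
    unfolding p_def using degree_power_le[of "\<Prod>j\<in>UNIV - {k}. [:- x j, 1:]" 2] deg by linarith
  then have "(\<Sum>j\<in>UNIV. \<omega> j * poly p (x j)) = integral {A..B} (poly p)"
    by (intro exact) linarith
  moreover have "poly p (x j) = 0" if "j \<noteq> k" for j
    using that by (auto simp: p_def poly_prod)
  then have "(\<Sum>j\<in>UNIV. \<omega> j * poly p (x j)) = \<omega> k * poly p (x k)"
    by (subst sum.remove[of _ k]) auto
  moreover have "integral {A..B} (poly p) \<ge> 0"
    by (rule integral_nonneg)
       (auto intro!: integrable_continuous_interval continuous_intros simp: p_def)
  moreover have "poly p (x k) > 0"
    using inj by (auto simp: p_def poly_prod inj_def)
  ultimately show "\<omega> k \<ge> 0"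
    by (metis zero_le_mult_iff not_less)
qed

text \<open>
  In the symmetric convention the weights are those of a rule on \<open>[-1, 1]\<close>, each one occurring twice,
  which gives total mass 1 again.
\<close>

lemma polar_rule_weights:
  fixes \<mu> \<omega> :: "'p::finite \<Rightarrow> real"
  assumes "polar_rule \<mu> \<omega>"
  shows "\<omega> k \<ge> 0" "(\<Sum>k\<in>UNIV. \<omega> k) = 1" "\<mu> k \<in> {0..1}"
proof -
  have "\<omega> k \<ge> 0 \<and> (\<Sum>k\<in>UNIV. \<omega> k) = 1 \<and> \<mu> k \<in> {0..1}"
    using assms unfolding polar_rule_def
  proof (elim disjE conjE)
    assume gl: "gauss_legendre 0 1 \<mu> \<omega>"
    show ?thesis
      using gauss_legendre_weights[OF gl] gl by (simp add: gauss_legendre_def image_subset_iff)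
  next
    assume range: "range \<mu> \<subseteq> {0..1}"
      and gl: "gauss_legendre (- 1) 1 (\<lambda>(k, s). if s then \<mu> k else - \<mu> k) (\<lambda>(k, s::bool). \<omega> k)"
    have "(\<Sum>z\<in>(UNIV :: ('p \<times> bool) set). case z of (k, s) \<Rightarrow> \<omega> k) = 2 * (\<Sum>k\<in>UNIV. \<omega> k)"
      unfolding UNIV_Times_UNIV[symmetric] sum.cartesian_product[symmetric]
      by (simp add: sum_distrib_left)
    then show ?thesis
      using gauss_legendre_weights(1)[OF gl, of "(k, True)"] gauss_legendre_weights(2)[OF gl] range
      by (simp add: image_subset_iff)
  qed
  then show "\<omega> k \<ge> 0" "(\<Sum>k\<in>UNIV. \<omega> k) = 1" "\<mu> k \<in> {0..1}" by auto
qed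

text \<open>
  What stability uses of the quadrature: it defines a positive measure of mass \<open>2 \<pi>\<close>, and its
  nodes are projections of points of the unit sphere.
\<close>

lemma tensor_gauss_legendre_bounds:
  fixes w :: "real^('p::finite \<times> 'r::finite)"
  assumes "tensor_gauss_legendre w \<Omega>"
  shows "w $ l \<ge> 0" "(\<Sum>l\<in>UNIV. w $ l) = 2 * pi"
    and "(\<Omega> Xdir $ l)\<^sup>2 + (\<Omega> Ydir $ l)\<^sup>2 \<le> 1"
proof -
  obtain \<mu> :: "'p \<Rightarrow> real" and \<omega> and \<theta> :: "'r \<Rightarrow> real" and \<eta> where
    polar: "polar_rule \<mu> \<omega>" and
    \<eta>: "\<And>m. \<eta> m > 0" "(\<Sum>m\<in>UNIV. \<eta> m) = 2 * pi" and
    w: "\<And>k m. w $ (k, m) = \<omega> k * \<eta> m" and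
    \<Omega>: "\<And>k m. \<Omega> Xdir $ (k, m) = sqrt (1 - (\<mu> k)\<^sup>2) * sin (\<theta> m)"
       "\<And>k m. \<Omega> Ydir $ (k, m) = sqrt (1 - (\<mu> k)\<^sup>2) * cos (\<theta> m)"
    using assms unfolding tensor_gauss_legendre_def by blast
  obtain k m where l: "l = (k, m)" by (cases l)
  show "w $ l \<ge> 0"
    using polar_rule_weights(1)[OF polar] \<eta>(1)[of m] by (simp add: l w less_imp_le)
  have "(\<Sum>l\<in>UNIV. w $ l) = (\<Sum>k\<in>UNIV. \<Sum>m\<in>UNIV. \<omega> k * \<eta> m)"
    unfolding UNIV_Times_UNIV[symmetric] sum.cartesian_product by (auto intro: sum.cong simp: w)
  also have "\<dots> = 2 * pi"
    using polar_rule_weights(2)[OF polar] \<eta>(2)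
    by (simp add: sum_distrib_left[symmetric] sum_distrib_right[symmetric])
  finally show "(\<Sum>l\<in>UNIV. w $ l) = 2 * pi" .
  have "(\<mu> k)\<^sup>2 \<le> 1"
    using polar_rule_weights(3)[OF polar, of k] by (simp add: power_le_one)
  then have "(\<Omega> Xdir $ l)\<^sup>2 + (\<Omega> Ydir $ l)\<^sup>2
      = (1 - (\<mu> k)\<^sup>2) * ((sin (\<theta> m))\<^sup>2 + (cos (\<theta> m))\<^sup>2)"
    by (simp add: l \<Omega> power_mult_distrib distrib_left del: sin_cos_squared_add sin_cos_squared_add2)
  then show "(\<Omega> Xdir $ l)\<^sup>2 + (\<Omega> Ydir $ l)\<^sup>2 \<le> 1" by simp
qed


section \<open>Summation by parts on a discrete torus\<close>

definition torus :: "(axis \<Rightarrow> nat) \<Rightarrow> index set" where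
  "torus M = {1..2 * int (M Xdir)} \<times> {1..2 * int (M Ydir)}"

definition periodic :: "(axis \<Rightarrow> nat) \<Rightarrow> (index \<Rightarrow> 'a) \<Rightarrow> bool" where
  "periodic M u \<longleftrightarrow>
     (\<forall>\<kappa>. u (\<kappa> + (2 * int (M Xdir), 0)) = u \<kappa> \<and> u (\<kappa> + (0, 2 * int (M Ydir))) = u \<kappa>)"

lemma periodic_shift:
  assumes "periodic M u"
  shows "periodic M (\<lambda>\<kappa>. u (\<kappa> + s))" "periodic M (\<lambda>\<kappa>. u (\<kappa> - s))"
proof -
  have "\<kappa> + t + s = (\<kappa> + s) + t" "\<kappa> + t - s = (\<kappa> - s) + t" for \<kappa> t :: index
    by (simp_all add: algebra_simps)
  then show "periodic M (\<lambda>\<kappa>. u (\<kappa> + s))" "periodic M (\<lambda>\<kappa>. u (\<kappa> - s))"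
    using assms by (simp_all only: periodic_def simp_thms)
qed

lemma periodic_apply:
  assumes "periodic M u"
  shows "periodic M (\<lambda>\<kappa>. f (u \<kappa>))"
  using assms by (simp add: periodic_def)

lemma periodic_apply2:
  assumes "periodic M u" "periodic M u'"
  shows "periodic M (\<lambda>\<kappa>. f (u \<kappa>) (u' \<kappa>))"
  using assms by (simp add: periodic_def)

lemma periodic_diff_ctr:
  assumes "periodic M u"
  shows "periodic M (diff_ctr \<Delta> v u)"
  unfolding diff_ctr_def
  by (rule periodic_apply2[OF periodic_shift(1)[OF assms] periodic_shift(2)[OF assms]])

lemma sum_shift_interval:
  fixes f :: "int \<Rightarrow> real"
  assumes "f (m + 1) = f 1" "m \<ge> 0"
  shows "(\<Sum>p\<in>{1..m}. f (p + 1)) = (\<Sum>p\<in>{1..m}. f p)"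
proof -
  have "(\<Sum>p\<in>{1..m}. f (p + 1)) = (\<Sum>p\<in>{2..m + 1}. f p)"
    by (rule sum.reindex_bij_witness[of _ "\<lambda>p. p - 1" "\<lambda>p. p + 1"]) auto
  also have "\<dots> = (\<Sum>p\<in>{1..m + 1} - {1}. f p)"
    by (rule sum.cong) auto
  also have "\<dots> = (\<Sum>p\<in>{1..m + 1}. f p) - f (m + 1)"
    using assms by (simp add: sum_diff1)
  also have "{1..m + 1} = insert (m + 1) {1..m}"
    using assms by auto
  finally show ?thesis by simp
qed

text \<open>
  Periodicity enters the estimates only through this translation invariance.
\<close>

lemma sum_torus_shift:
  fixes F :: "index \<Rightarrow> real"
  assumes "periodic M F"
  shows "(\<Sum>\<kappa>\<in>torus M. F (\<kappa> + unit_step v)) = sum F (torus M)"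
proof -
  have per: "F (p + 2 * int (M Xdir), q) = F (p, q)" "F (p, q + 2 * int (M Ydir)) = F (p, q)"
    for p q using assms by (auto simp: periodic_def)
  show ?thesis
  proof (cases v)
    case Xdir
    have "(\<Sum>\<kappa>\<in>torus M. F (\<kappa> + unit_step v))
        = (\<Sum>q\<in>{1..2 * int (M Ydir)}. \<Sum>p\<in>{1..2 * int (M Xdir)}. F (p + 1, q))"
      unfolding torus_def Xdir
      by (subst sum.swap) (simp add: sum.cartesian_product case_prod_unfold plus_prod_def)
    also have "\<dots> = (\<Sum>q\<in>{1..2 * int (M Ydir)}. \<Sum>p\<in>{1..2 * int (M Xdir)}. F (p, q))"
      by (intro sum.cong refl sum_shift_interval) (use per(1)[of 1] in \<open>simp_all add: add.commute\<close>)
    finally show ?thesis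
      unfolding torus_def by (subst (asm) sum.swap) (simp add: sum.cartesian_product)
  next
    case Ydir
    have "(\<Sum>\<kappa>\<in>torus M. F (\<kappa> + unit_step v))
        = (\<Sum>p\<in>{1..2 * int (M Xdir)}. \<Sum>q\<in>{1..2 * int (M Ydir)}. F (p, q + 1))"
      unfolding torus_def Ydir
      by (simp add: sum.cartesian_product case_prod_unfold plus_prod_def)
    also have "\<dots> = (\<Sum>p\<in>{1..2 * int (M Xdir)}. \<Sum>q\<in>{1..2 * int (M Ydir)}. F (p, q))"
      by (intro sum.cong refl sum_shift_interval) (use per(2)[of _ 1] in \<open>simp_all add: add.commute\<close>)
    finally show ?thesis
      unfolding torus_def by (simp add: sum.cartesian_product)
  qed
qed

lemma sum_torus_shift_back:
  fixes F :: "index \<Rightarrow> real"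
  assumes "periodic M F"
  shows "(\<Sum>\<kappa>\<in>torus M. F (\<kappa> - unit_step v)) = sum F (torus M)"
  using sum_torus_shift[OF periodic_shift(2)[OF assms, of "unit_step v"], of v] by simp

lemma sum_torus_shift_mult:
  fixes y z :: "index \<Rightarrow> real"
  assumes "periodic M y" "periodic M z"
  shows "(\<Sum>\<kappa>\<in>torus M. y \<kappa> * z (\<kappa> + unit_step v)) = (\<Sum>\<kappa>\<in>torus M. y (\<kappa> - unit_step v) * z \<kappa>)"
  using sum_torus_shift[OF periodic_apply2[OF periodic_shift(2)[OF assms(1), of "unit_step v"] assms(2)],
      of "(*)" v] by simp

text \<open>
  The one-sided differences are half-step translates of the staggered one. All three therefore have
  the same norm on the torus, and summation by parts is needed for the staggered one only.
\<close>

lemma diff_fwd_eq_ctr: "diff_fwd \<Delta> v u \<kappa> = diff_ctr \<Delta> v u (\<kappa> + unit_step v)"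
  and diff_bwd_eq_ctr: "diff_bwd \<Delta> v u \<kappa> = diff_ctr \<Delta> v u (\<kappa> - unit_step v)"
  by (simp_all add: diff_fwd_def diff_bwd_def diff_ctr_def)

lemma sum_by_parts_ctr:
  fixes y z :: "index \<Rightarrow> real"
  assumes "periodic M y" "periodic M z"
  shows "(\<Sum>\<kappa>\<in>torus M. y \<kappa> * diff_ctr \<Delta> v z \<kappa>) = - (\<Sum>\<kappa>\<in>torus M. z \<kappa> * diff_ctr \<Delta> v y \<kappa>)"
proof -
  have 1: "(\<Sum>\<kappa>\<in>torus M. y \<kappa> * z (\<kappa> + unit_step v)) = (\<Sum>\<kappa>\<in>torus M. z \<kappa> * y (\<kappa> - unit_step v))"
    using sum_torus_shift_mult[OF assms] by (simp add: mult.commute)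
  have 2: "(\<Sum>\<kappa>\<in>torus M. z \<kappa> * y (\<kappa> + unit_step v)) = (\<Sum>\<kappa>\<in>torus M. y \<kappa> * z (\<kappa> - unit_step v))"
    using sum_torus_shift_mult[OF assms(2,1)] by (simp add: mult.commute)
  have "(\<Sum>\<kappa>\<in>torus M. y \<kappa> * diff_ctr \<Delta> v z \<kappa>)
      = ((\<Sum>\<kappa>\<in>torus M. y \<kappa> * z (\<kappa> + unit_step v)) - (\<Sum>\<kappa>\<in>torus M. y \<kappa> * z (\<kappa> - unit_step v))) / \<Delta> v"
    by (simp add: diff_ctr_def sum_subtractf[symmetric] sum_divide_distrib divide_inverse algebra_simps
        sum_distrib_left)
  moreover have "(\<Sum>\<kappa>\<in>torus M. z \<kappa> * diff_ctr \<Delta> v y \<kappa>)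
      = ((\<Sum>\<kappa>\<in>torus M. z \<kappa> * y (\<kappa> + unit_step v)) - (\<Sum>\<kappa>\<in>torus M. z \<kappa> * y (\<kappa> - unit_step v))) / \<Delta> v"
    by (simp add: diff_ctr_def sum_subtractf[symmetric] sum_divide_distrib divide_inverse algebra_simps
        sum_distrib_left)
  ultimately show ?thesis
    by (simp add: 1 2 minus_divide_left[symmetric] diff_divide_distrib)
qed

lemma diff_ctr_shift:
  "diff_ctr \<Delta> v (\<lambda>\<kappa>. u (\<kappa> - s)) \<kappa> = diff_ctr \<Delta> v u (\<kappa> - s)"
  by (simp add: diff_ctr_def algebra_simps)

lemma sum_by_parts_one_sided:
  fixes y z :: "index \<Rightarrow> real"
  assumes "periodic M y" "periodic M z"
  shows "(\<Sum>\<kappa>\<in>torus M. y \<kappa> * diff_fwd \<Delta> v z \<kappa>) = - (\<Sum>\<kappa>\<in>torus M. z \<kappa> * diff_bwd \<Delta> v y \<kappa>)"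
proof -
  have "(\<Sum>\<kappa>\<in>torus M. y \<kappa> * diff_fwd \<Delta> v z \<kappa>)
      = (\<Sum>\<kappa>\<in>torus M. y (\<kappa> - unit_step v) * diff_ctr \<Delta> v z \<kappa>)"
    unfolding diff_fwd_eq_ctr
    by (rule sum_torus_shift_mult) (intro assms periodic_diff_ctr)+
  also have "\<dots> = - (\<Sum>\<kappa>\<in>torus M. z \<kappa> * diff_bwd \<Delta> v y \<kappa>)"
    by (subst sum_by_parts_ctr[OF periodic_shift(2)[OF assms(1)] assms(2)])
       (simp add: diff_ctr_shift diff_bwd_eq_ctr)
  finally show ?thesis .
qed

text \<open>
  By summation by parts the two sums are opposite, and their difference is
  \<open>\<Delta>v\<close> times the squared norm of the staggered difference. This is the numerical viscosity.
\<close>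

lemma sum_mult_one_sided_self:
  fixes z :: "index \<Rightarrow> real"
  assumes "periodic M z" "\<Delta> v > 0"
  shows "(\<Sum>\<kappa>\<in>torus M. z \<kappa> * diff_fwd \<Delta> v z \<kappa>) = - \<Delta> v / 2 * (\<Sum>\<kappa>\<in>torus M. (diff_ctr \<Delta> v z \<kappa>)\<^sup>2)"
    and "(\<Sum>\<kappa>\<in>torus M. z \<kappa> * diff_bwd \<Delta> v z \<kappa>) = \<Delta> v / 2 * (\<Sum>\<kappa>\<in>torus M. (diff_ctr \<Delta> v z \<kappa>)\<^sup>2)"
proof -
  have fwd: "(\<Sum>\<kappa>\<in>torus M. z \<kappa> * diff_fwd \<Delta> v z \<kappa>)
      = (\<Sum>\<kappa>\<in>torus M. z (\<kappa> - unit_step v) * diff_ctr \<Delta> v z \<kappa>)"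
    unfolding diff_fwd_eq_ctr
    by (rule sum_torus_shift_mult) (intro assms periodic_diff_ctr)+
  have bwd: "(\<Sum>\<kappa>\<in>torus M. z \<kappa> * diff_bwd \<Delta> v z \<kappa>)
      = (\<Sum>\<kappa>\<in>torus M. z (\<kappa> + unit_step v) * diff_ctr \<Delta> v z \<kappa>)"
    using sum_torus_shift_mult[OF periodic_diff_ctr[OF assms(1)] assms(1), of \<Delta> v v]
    by (simp add: diff_bwd_eq_ctr mult.commute)
  have "(\<Sum>\<kappa>\<in>torus M. z \<kappa> * diff_bwd \<Delta> v z \<kappa>) - (\<Sum>\<kappa>\<in>torus M. z \<kappa> * diff_fwd \<Delta> v z \<kappa>)
      = (\<Sum>\<kappa>\<in>torus M. (z (\<kappa> + unit_step v) - z (\<kappa> - unit_step v)) * diff_ctr \<Delta> v z \<kappa>)"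
    unfolding fwd bwd by (simp add: sum_subtractf left_diff_distrib)
  also have "\<dots> = \<Delta> v * (\<Sum>\<kappa>\<in>torus M. (diff_ctr \<Delta> v z \<kappa>)\<^sup>2)"
    unfolding sum_distrib_left
    by (rule sum.cong) (use assms(2) in \<open>simp_all add: diff_ctr_def power2_eq_square\<close>)
  finally show "(\<Sum>\<kappa>\<in>torus M. z \<kappa> * diff_fwd \<Delta> v z \<kappa>) = - \<Delta> v / 2 * (\<Sum>\<kappa>\<in>torus M. (diff_ctr \<Delta> v z \<kappa>)\<^sup>2)"
    and "(\<Sum>\<kappa>\<in>torus M. z \<kappa> * diff_bwd \<Delta> v z \<kappa>) = \<Delta> v / 2 * (\<Sum>\<kappa>\<in>torus M. (diff_ctr \<Delta> v z \<kappa>)\<^sup>2)"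
    using sum_by_parts_one_sided[OF assms(1) assms(1), of \<Delta> v] by simp_all
qed

text \<open>
  Inverse inequality: a difference quotient is bounded by the field itself at the cost of the grid
  size. It lets the collision term pay for differences when \<open>\<epsilon>\<close> is small.
\<close>

lemma sum_square_diff_ctr_le:
  fixes z :: "index \<Rightarrow> real"
  assumes "periodic M z" "\<Delta> v > 0"
  shows "(\<Delta> v)\<^sup>2 / 4 * (\<Sum>\<kappa>\<in>torus M. (diff_ctr \<Delta> v z \<kappa>)\<^sup>2) \<le> (\<Sum>\<kappa>\<in>torus M. (z \<kappa>)\<^sup>2)"
proof -
  let ?sq = "\<lambda>\<kappa>. (z \<kappa>)\<^sup>2"
  have per: "periodic M ?sq" by (rule periodic_apply[OF assms(1)])
  have pointwise: "(\<Delta> v)\<^sup>2 / 4 * (diff_ctr \<Delta> v z \<kappa>)\<^sup>2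
      \<le> ((z (\<kappa> + unit_step v))\<^sup>2 + (z (\<kappa> - unit_step v))\<^sup>2) / 2" for \<kappa>
  proof -
    have "(\<Delta> v)\<^sup>2 / 4 * (diff_ctr \<Delta> v z \<kappa>)\<^sup>2
        = (z (\<kappa> + unit_step v) - z (\<kappa> - unit_step v))\<^sup>2 / 4"
      using assms(2) by (simp add: diff_ctr_def power_mult_distrib field_simps)
    also have "\<dots> \<le> ((z (\<kappa> + unit_step v))\<^sup>2 + (z (\<kappa> - unit_step v))\<^sup>2) / 2"
      using zero_le_power2[of "z (\<kappa> + unit_step v) + z (\<kappa> - unit_step v)"]
      by (simp add: power2_sum power2_diff)
    finally show ?thesis .
  qed
  have "(\<Delta> v)\<^sup>2 / 4 * (\<Sum>\<kappa>\<in>torus M. (diff_ctr \<Delta> v z \<kappa>)\<^sup>2)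
      \<le> (\<Sum>\<kappa>\<in>torus M. ((z (\<kappa> + unit_step v))\<^sup>2 + (z (\<kappa> - unit_step v))\<^sup>2) / 2)"
    unfolding sum_distrib_left by (rule sum_mono) (rule pointwise)
  also have "\<dots> = (\<Sum>\<kappa>\<in>torus M. (z \<kappa>)\<^sup>2)"
    using sum_torus_shift[OF per, of v] sum_torus_shift_back[OF per, of v]
    by (simp add: sum_divide_distrib[symmetric] sum.distrib)
  finally show ?thesis .
qed


section \<open>Dissipation under the CFL condition\<close>

text \<open>
  The \<open>l\<close>-th component of \<open>upwind\<close> for \<open>s = \<Omega> v $ l\<close>: the matrices are diagonal, so ordinates
  decouple (\<open>upwind_nth\<close>).
\<close>

definition upwind_ordinate ::
  "(axis \<Rightarrow> real) \<Rightarrow> real \<Rightarrow> axis \<Rightarrow> (index \<Rightarrow> real) \<Rightarrow> index \<Rightarrow> real" where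
  "upwind_ordinate \<Delta> s v z \<kappa> = min s 0 * diff_fwd \<Delta> v z \<kappa> + max s 0 * diff_bwd \<Delta> v z \<kappa>"

text \<open>
  The negative of the adjoint of \<open>upwind_ordinate\<close> on the torus (\<open>sum_by_parts_upwind\<close>).
\<close>

definition downwind_ordinate ::
  "(axis \<Rightarrow> real) \<Rightarrow> real \<Rightarrow> axis \<Rightarrow> (index \<Rightarrow> real) \<Rightarrow> index \<Rightarrow> real" where
  "downwind_ordinate \<Delta> s v z \<kappa> = min s 0 * diff_bwd \<Delta> v z \<kappa> + max s 0 * diff_fwd \<Delta> v z \<kappa>"

lemma diag_mat_mult_nth: "(diag_mat d *v x) $ l = d $ l * x $ l"
  by (simp add: diag_mat_def matrix_vector_mult_def if_distrib[of "\<lambda>t. t * _"] cong: if_cong)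

lemma diff_ctr_nth: "diff_ctr \<Delta> v g \<kappa> $ l = diff_ctr \<Delta> v (\<lambda>\<kappa>. g \<kappa> $ l) \<kappa>"
  by (simp add: diff_ctr_def)

lemma upwind_nth:
  "upwind \<Delta> \<Omega> v g \<kappa> $ l = upwind_ordinate \<Delta> (\<Omega> v $ l) v (\<lambda>\<kappa>. g \<kappa> $ l) \<kappa>"
proof -
  have "Q_minus \<Omega> v *v x = (1 / 2) *\<^sub>R (Q \<Omega> v *v x - Q_abs \<Omega> v *v x)"
    and "Q_plus \<Omega> v *v x = (1 / 2) *\<^sub>R (Q \<Omega> v *v x + Q_abs \<Omega> v *v x)" for x
    unfolding Q_minus_def Q_plus_def
    by (simp_all only: scaleR_matrix_vector_assoc[symmetric] matrix_vector_mult_diff_rdistrib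
        matrix_vector_mult_add_rdistrib)
  then show ?thesis
    by (auto simp: upwind_def upwind_ordinate_def Q_def Q_abs_def diag_mat_mult_nth diff_fwd_def
        diff_bwd_def min_def max_def)
qed

lemma sum_by_parts_upwind:
  assumes "periodic M y" "periodic M z"
  shows "(\<Sum>\<kappa>\<in>torus M. y \<kappa> * upwind_ordinate \<Delta> s v z \<kappa>)
       = - (\<Sum>\<kappa>\<in>torus M. z \<kappa> * downwind_ordinate \<Delta> s v y \<kappa>)"
proof -
  have "(\<Sum>\<kappa>\<in>torus M. y \<kappa> * upwind_ordinate \<Delta> s v z \<kappa>)
      = min s 0 * (\<Sum>\<kappa>\<in>torus M. y \<kappa> * diff_fwd \<Delta> v z \<kappa>)
        + max s 0 * (\<Sum>\<kappa>\<in>torus M. y \<kappa> * diff_bwd \<Delta> v z \<kappa>)"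
    unfolding sum_distrib_left sum.distrib[symmetric]
    by (rule sum.cong) (simp_all add: upwind_ordinate_def algebra_simps)
  also have "\<dots> = - (min s 0 * (\<Sum>\<kappa>\<in>torus M. z \<kappa> * diff_bwd \<Delta> v y \<kappa>)
        + max s 0 * (\<Sum>\<kappa>\<in>torus M. z \<kappa> * diff_fwd \<Delta> v y \<kappa>))"
    using sum_by_parts_one_sided[OF assms, of \<Delta> v] sum_by_parts_one_sided[OF assms(2,1), of \<Delta> v]
    by simp
  also have "\<dots> = - (\<Sum>\<kappa>\<in>torus M. z \<kappa> * downwind_ordinate \<Delta> s v y \<kappa>)"
    unfolding sum_distrib_left sum.distrib[symmetric]
    by (intro arg_cong[of _ _ uminus] sum.cong) (simp_all add: downwind_ordinate_def algebra_simps)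
  finally show ?thesis .
qed

lemma upwind_dissipation:
  assumes "periodic M z" "\<Delta> v > 0"
  shows "(\<Sum>\<kappa>\<in>torus M. z \<kappa> * upwind_ordinate \<Delta> s v z \<kappa>)
       = \<bar>s\<bar> * \<Delta> v / 2 * (\<Sum>\<kappa>\<in>torus M. (diff_ctr \<Delta> v z \<kappa>)\<^sup>2)"
proof -
  have "(\<Sum>\<kappa>\<in>torus M. z \<kappa> * upwind_ordinate \<Delta> s v z \<kappa>)
      = min s 0 * (\<Sum>\<kappa>\<in>torus M. z \<kappa> * diff_fwd \<Delta> v z \<kappa>)
        + max s 0 * (\<Sum>\<kappa>\<in>torus M. z \<kappa> * diff_bwd \<Delta> v z \<kappa>)"
    unfolding sum_distrib_left sum.distrib[symmetric]
    by (rule sum.cong) (simp_all add: upwind_ordinate_def algebra_simps)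
  also have "\<dots> = \<bar>s\<bar> * \<Delta> v / 2 * (\<Sum>\<kappa>\<in>torus M. (diff_ctr \<Delta> v z \<kappa>)\<^sup>2)"
    unfolding sum_mult_one_sided_self[of M z \<Delta> v, OF assms] by (auto simp: min_def max_def)
  finally show ?thesis .
qed

text \<open>
  Cauchy-Schwarz with weights \<open>\<bar>s\<bar>\<close> and \<open>\<bar>t\<bar>\<close> gives the factor \<open>\<bar>s\<bar> + \<bar>t\<bar> \<le> sqrt 2\<close>. Keeping the first
  power of the weights on the right matches the numerical viscosity, which is linear in them; the
  bound \<open>2 (s\<^sup>2 x\<^sup>2 + t\<^sup>2 y\<^sup>2)\<close> has the larger factor 2 when one of the weights is 1.
\<close>

lemma square_direction_le:
  fixes s t x y :: real
  assumes "s\<^sup>2 + t\<^sup>2 \<le> 1"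
  shows "(s * x + t * y)\<^sup>2 \<le> 3 / 2 * (\<bar>s\<bar> * x\<^sup>2 + \<bar>t\<bar> * y\<^sup>2)"
proof -
  have "(\<bar>s\<bar> + \<bar>t\<bar>)\<^sup>2 = 2 * (s\<^sup>2 + t\<^sup>2) - (\<bar>s\<bar> - \<bar>t\<bar>)\<^sup>2"
    by (simp add: power2_sum power2_diff)
  also have "\<dots> \<le> 2 * 1 - 0"
    by (intro diff_mono mult_left_mono assms) simp_all
  finally have "(\<bar>s\<bar> + \<bar>t\<bar>)\<^sup>2 \<le> 2" by simp
  then have "(\<bar>s\<bar> + \<bar>t\<bar>)\<^sup>2 \<le> (3 / 2)\<^sup>2"
    by (simp add: power2_eq_square)
  then have le: "\<bar>s\<bar> + \<bar>t\<bar> \<le> 3 / 2"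
    by (rule power2_le_imp_le) simp
  have "\<bar>s * x + t * y\<bar> \<le> \<bar>s\<bar> * \<bar>x\<bar> + \<bar>t\<bar> * \<bar>y\<bar>"
    by (metis abs_mult abs_triangle_ineq)
  then have "(s * x + t * y)\<^sup>2 \<le> (\<bar>s\<bar> * \<bar>x\<bar> + \<bar>t\<bar> * \<bar>y\<bar>)\<^sup>2"
    by (metis abs_ge_zero power2_abs power_mono)
  also have "\<dots> = (\<bar>s\<bar> + \<bar>t\<bar>) * (\<bar>s\<bar> * x\<^sup>2 + \<bar>t\<bar> * y\<^sup>2) - \<bar>s\<bar> * \<bar>t\<bar> * (\<bar>x\<bar> - \<bar>y\<bar>)\<^sup>2"
    unfolding power2_abs[of x, symmetric] power2_abs[of y, symmetric]
    by (simp add: power2_eq_square algebra_simps del: abs_mult_self_eq)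
  also have "\<dots> \<le> (\<bar>s\<bar> + \<bar>t\<bar>) * (\<bar>s\<bar> * x\<^sup>2 + \<bar>t\<bar> * y\<^sup>2)"
    by simp
  also have "\<dots> \<le> 3 / 2 * (\<bar>s\<bar> * x\<^sup>2 + \<bar>t\<bar> * y\<^sup>2)"
    by (intro mult_right_mono le) simp
  finally show ?thesis .
qed

text \<open>
  For each axis the downwind operator is the speed times a single one-sided difference, chosen by
  the sign of the speed.
\<close>

lemma sum_square_downwind_le:
  fixes s :: "axis \<Rightarrow> real" and z :: "index \<Rightarrow> real"
  assumes per: "periodic M z" and dir: "(s Xdir)\<^sup>2 + (s Ydir)\<^sup>2 \<le> 1"
  shows "(\<Sum>\<kappa>\<in>torus M. (\<Sum>v\<in>{Xdir, Ydir}. downwind_ordinate \<Delta> (s v) v z \<kappa>)\<^sup>2)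
       \<le> 3 / 2 * (\<Sum>v\<in>{Xdir, Ydir}. \<bar>s v\<bar> * (\<Sum>\<kappa>\<in>torus M. (diff_ctr \<Delta> v z \<kappa>)\<^sup>2))"
proof -
  define D where "D v \<kappa> = (if s v < 0 then diff_bwd \<Delta> v z \<kappa> else diff_fwd \<Delta> v z \<kappa>)" for v \<kappa>
  have down: "downwind_ordinate \<Delta> (s v) v z \<kappa> = s v * D v \<kappa>" for v \<kappa>
    by (simp add: downwind_ordinate_def D_def)
  have per_sq: "periodic M (\<lambda>\<kappa>. (diff_ctr \<Delta> v z \<kappa>)\<^sup>2)" for v
    by (rule periodic_apply[OF periodic_diff_ctr[OF per]])
  have D: "(\<Sum>\<kappa>\<in>torus M. (D v \<kappa>)\<^sup>2) = (\<Sum>\<kappa>\<in>torus M. (diff_ctr \<Delta> v z \<kappa>)\<^sup>2)" for v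
    using sum_torus_shift[OF per_sq, of v v] sum_torus_shift_back[OF per_sq, of v v]
    by (cases "s v < 0") (simp_all add: D_def diff_fwd_eq_ctr diff_bwd_eq_ctr)
  have "(\<Sum>\<kappa>\<in>torus M. (\<Sum>v\<in>{Xdir, Ydir}. downwind_ordinate \<Delta> (s v) v z \<kappa>)\<^sup>2)
      \<le> (\<Sum>\<kappa>\<in>torus M. 3 / 2 * (\<bar>s Xdir\<bar> * (D Xdir \<kappa>)\<^sup>2 + \<bar>s Ydir\<bar> * (D Ydir \<kappa>)\<^sup>2))"
    by (rule sum_mono) (use square_direction_le[OF dir] in \<open>simp add: down\<close>)
  also have "\<dots> = 3 / 2 * (\<Sum>v\<in>{Xdir, Ydir}. \<bar>s v\<bar> * (\<Sum>\<kappa>\<in>torus M. (D v \<kappa>)\<^sup>2))"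
    unfolding sum_distrib_left[symmetric] sum.distrib by simp
  finally show ?thesis
    unfolding D .
qed

lemma sum_square_advection_le:
  fixes s :: "axis \<Rightarrow> real" and z :: "index \<Rightarrow> real"
  assumes dir: "(s Xdir)\<^sup>2 + (s Ydir)\<^sup>2 \<le> 1"
  shows "(\<Sum>\<kappa>\<in>torus M. (\<Sum>v\<in>{Xdir, Ydir}. s v * diff_ctr \<Delta> v z \<kappa>)\<^sup>2)
       \<le> 3 / 2 * (\<Sum>v\<in>{Xdir, Ydir}. \<bar>s v\<bar> * (\<Sum>\<kappa>\<in>torus M. (diff_ctr \<Delta> v z \<kappa>)\<^sup>2))"
proof -
  have "(\<Sum>\<kappa>\<in>torus M. (\<Sum>v\<in>{Xdir, Ydir}. s v * diff_ctr \<Delta> v z \<kappa>)\<^sup>2)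
      \<le> (\<Sum>\<kappa>\<in>torus M. 3 / 2 * (\<bar>s Xdir\<bar> * (diff_ctr \<Delta> Xdir z \<kappa>)\<^sup>2
                               + \<bar>s Ydir\<bar> * (diff_ctr \<Delta> Ydir z \<kappa>)\<^sup>2))"
    by (rule sum_mono) (use square_direction_le[OF dir] in simp)
  also have "\<dots> = 3 / 2 * (\<Sum>v\<in>{Xdir, Ydir}. \<bar>s v\<bar> * (\<Sum>\<kappa>\<in>torus M. (diff_ctr \<Delta> v z \<kappa>)\<^sup>2))"
    unfolding sum_distrib_left[symmetric] sum.distrib by simp
  finally show ?thesis .
qed

text \<open>
  The heart of the argument, for one ordinate with velocity \<open>s\<close>; \<open>y\<close> and \<open>z\<close> are the old and the new
  time level. Split \<open>y = z - d\<close>. The part with \<open>z\<close> is pure dissipation. The part with \<open>d\<close> moves to \<open>z\<close> by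
  adjointness and is absorbed in \<open>\<epsilon>\<^sup>2 d\<^sup>2\<close>, at a cost with the same bound as the left-hand side;
  twice this bound is exactly what the CFL condition allows. The left-hand side is the reserve that pays for the
  flux in the macroscopic equation.
\<close>

lemma ordinate_dissipation:
  fixes s \<Delta> :: "axis \<Rightarrow> real" and y z :: "index \<Rightarrow> real" and \<epsilon> \<tau> \<sigma> :: real
  assumes per: "periodic M y" "periodic M z"
    and dir: "(s Xdir)\<^sup>2 + (s Ydir)\<^sup>2 \<le> 1"
    and pos: "\<tau> \<ge> 0" "\<sigma> \<ge> 0" "\<And>v. \<Delta> v > 0"
    and cfl: "\<And>v. 3 * \<tau> * \<bar>s v\<bar> \<le> \<epsilon> * \<Delta> v * \<bar>s v\<bar> + \<sigma> * (\<Delta> v)\<^sup>2 / 4"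
  shows "\<tau>\<^sup>2 * (\<Sum>\<kappa>\<in>torus M. (\<Sum>v\<in>{Xdir, Ydir}. s v * diff_ctr \<Delta> v z \<kappa>)\<^sup>2)
       \<le> (\<Sum>\<kappa>\<in>torus M. \<epsilon>\<^sup>2 * (z \<kappa> - y \<kappa>)\<^sup>2
            + 2 * \<tau> * \<epsilon> * (z \<kappa> * (\<Sum>v\<in>{Xdir, Ydir}. upwind_ordinate \<Delta> (s v) v y \<kappa>))
            + 2 * \<tau> * \<sigma> * (z \<kappa>)\<^sup>2)"
proof -
  define d where "d \<kappa> = z \<kappa> - y \<kappa>" for \<kappa>
  define \<psi> where "\<psi> \<kappa> = (\<Sum>v\<in>{Xdir, Ydir}. downwind_ordinate \<Delta> (s v) v z \<kappa>)" for \<kappa>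
  define G where "G v = (\<Sum>\<kappa>\<in>torus M. (diff_ctr \<Delta> v z \<kappa>)\<^sup>2)" for v
  have per_d: "periodic M d"
    unfolding d_def by (rule periodic_apply2[OF per(2,1)])
  have G_nonneg: "G v \<ge> 0" for v
    unfolding G_def by (rule sum_nonneg) simp
  have upwind_y: "upwind_ordinate \<Delta> (s v) v y \<kappa>
      = upwind_ordinate \<Delta> (s v) v z \<kappa> - upwind_ordinate \<Delta> (s v) v d \<kappa>" for v \<kappa>
    by (simp add: upwind_ordinate_def diff_fwd_def diff_bwd_def d_def algebra_simps)
  have axis: "(\<Sum>\<kappa>\<in>torus M. z \<kappa> * upwind_ordinate \<Delta> (s v) v y \<kappa>)
      = \<bar>s v\<bar> * \<Delta> v / 2 * G v + (\<Sum>\<kappa>\<in>torus M. d \<kappa> * downwind_ordinate \<Delta> (s v) v z \<kappa>)" for v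
    unfolding upwind_y right_diff_distrib sum_subtractf upwind_dissipation[of M z \<Delta>, OF per(2) pos(3)]
      sum_by_parts_upwind[OF per(2) per_d] G_def by simp
  have advection: "(\<Sum>\<kappa>\<in>torus M. z \<kappa> * (\<Sum>v\<in>{Xdir, Ydir}. upwind_ordinate \<Delta> (s v) v y \<kappa>))
      = (\<Sum>v\<in>{Xdir, Ydir}. \<bar>s v\<bar> * \<Delta> v / 2 * G v) + (\<Sum>\<kappa>\<in>torus M. d \<kappa> * \<psi> \<kappa>)"
    using axis[of Xdir] axis[of Ydir] by (simp add: \<psi>_def distrib_left sum.distrib)
  have young: "- (\<tau>\<^sup>2 * (\<Sum>\<kappa>\<in>torus M. (\<psi> \<kappa>)\<^sup>2))
      \<le> \<epsilon>\<^sup>2 * (\<Sum>\<kappa>\<in>torus M. (d \<kappa>)\<^sup>2) + 2 * \<tau> * \<epsilon> * (\<Sum>\<kappa>\<in>torus M. d \<kappa> * \<psi> \<kappa>)"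
  proof -
    have "0 \<le> (\<Sum>\<kappa>\<in>torus M. (\<epsilon> * d \<kappa> + \<tau> * \<psi> \<kappa>)\<^sup>2)"
      by (rule sum_nonneg) simp
    also have "\<dots> = \<epsilon>\<^sup>2 * (\<Sum>\<kappa>\<in>torus M. (d \<kappa>)\<^sup>2) + 2 * \<tau> * \<epsilon> * (\<Sum>\<kappa>\<in>torus M. d \<kappa> * \<psi> \<kappa>)
        + \<tau>\<^sup>2 * (\<Sum>\<kappa>\<in>torus M. (\<psi> \<kappa>)\<^sup>2)"
      unfolding sum_distrib_left sum.distrib[symmetric]
      by (rule sum.cong) (simp_all add: power2_eq_square algebra_simps)
    finally show ?thesis by linarith
  qed
  have "\<tau>\<^sup>2 * (\<Sum>\<kappa>\<in>torus M. (\<psi> \<kappa>)\<^sup>2) \<le> \<tau>\<^sup>2 * (3 / 2 * (\<Sum>v\<in>{Xdir, Ydir}. \<bar>s v\<bar> * G v))"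
    and "\<tau>\<^sup>2 * (\<Sum>\<kappa>\<in>torus M. (\<Sum>v\<in>{Xdir, Ydir}. s v * diff_ctr \<Delta> v z \<kappa>)\<^sup>2)
      \<le> \<tau>\<^sup>2 * (3 / 2 * (\<Sum>v\<in>{Xdir, Ydir}. \<bar>s v\<bar> * G v))"
    unfolding \<psi>_def G_def
    by (intro mult_left_mono sum_square_downwind_le sum_square_advection_le per dir zero_le_power2)+
  \<comment> \<open>One half of the collision term for each axis.\<close>
  moreover have "2 * \<tau> * \<sigma> * (\<Sum>\<kappa>\<in>torus M. (z \<kappa>)\<^sup>2)
      \<ge> 2 * \<tau> * \<sigma> * ((\<Sum>v\<in>{Xdir, Ydir}. (\<Delta> v)\<^sup>2 / 4 * G v) / 2)"
    using sum_square_diff_ctr_le[of M z \<Delta>, OF per(2) pos(3), of Xdir]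
      sum_square_diff_ctr_le[of M z \<Delta>, OF per(2) pos(3), of Ydir] pos(1,2)
    by (intro mult_left_mono) (simp_all add: G_def)
  \<comment> \<open>The factor 2 on the left: the square of \<open>\<psi>\<close> and the reserve are paid together.\<close>
  moreover have cfl_axis: "2 * (\<tau>\<^sup>2 * (3 / 2 * (\<bar>s v\<bar> * G v)))
      \<le> 2 * \<tau> * \<epsilon> * (\<bar>s v\<bar> * \<Delta> v / 2 * G v) + 2 * \<tau> * \<sigma> * ((\<Delta> v)\<^sup>2 / 4 * G v / 2)" for v
  proof -
    have "\<tau> * (3 * \<tau> * \<bar>s v\<bar> * G v) \<le> \<tau> * ((\<epsilon> * \<Delta> v * \<bar>s v\<bar> + \<sigma> * (\<Delta> v)\<^sup>2 / 4) * G v)"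
      by (intro mult_left_mono mult_right_mono cfl G_nonneg pos)
    then show ?thesis
      by (simp add: power2_eq_square algebra_simps)
  qed
  then have "2 * (\<tau>\<^sup>2 * (3 / 2 * (\<Sum>v\<in>{Xdir, Ydir}. \<bar>s v\<bar> * G v)))
      \<le> 2 * \<tau> * \<epsilon> * (\<Sum>v\<in>{Xdir, Ydir}. \<bar>s v\<bar> * \<Delta> v / 2 * G v)
        + 2 * \<tau> * \<sigma> * ((\<Sum>v\<in>{Xdir, Ydir}. (\<Delta> v)\<^sup>2 / 4 * G v) / 2)"
    unfolding sum_distrib_left sum_divide_distrib sum.distrib[symmetric] by (rule sum_mono)
  ultimately have "\<tau>\<^sup>2 * (\<Sum>\<kappa>\<in>torus M. (\<Sum>v\<in>{Xdir, Ydir}. s v * diff_ctr \<Delta> v z \<kappa>)\<^sup>2)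
      \<le> \<epsilon>\<^sup>2 * (\<Sum>\<kappa>\<in>torus M. (d \<kappa>)\<^sup>2)
        + 2 * \<tau> * \<epsilon> * (\<Sum>\<kappa>\<in>torus M. z \<kappa> * (\<Sum>v\<in>{Xdir, Ydir}. upwind_ordinate \<Delta> (s v) v y \<kappa>))
        + 2 * \<tau> * \<sigma> * (\<Sum>\<kappa>\<in>torus M. (z \<kappa>)\<^sup>2)"
    using young unfolding advection distrib_left by linarith
  then show ?thesis
    by (simp only: d_def sum_distrib_left sum.distrib)
qed

lemma square_weighted_sum_le:
  fixes w x :: "'q::finite \<Rightarrow> real"
  assumes "\<And>l. w l \<ge> 0"
  shows "(\<Sum>l\<in>UNIV. w l * x l)\<^sup>2 \<le> (\<Sum>l\<in>UNIV. w l) * (\<Sum>l\<in>UNIV. w l * (x l)\<^sup>2)"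
proof -
  have "(\<Sum>l\<in>UNIV. sqrt (w l) * (sqrt (w l) * x l))\<^sup>2
      \<le> (\<Sum>l\<in>UNIV. (sqrt (w l))\<^sup>2) * (\<Sum>l\<in>UNIV. (sqrt (w l) * x l)\<^sup>2)"
    by (rule Cauchy_Schwarz_ineq_sum)
  then show ?thesis
    using assms by (simp add: power_mult_distrib mult.assoc[symmetric])
qed

text \<open>
  The increment \<open>d\<close> of \<open>u\<close> absorbs the flux by Young's inequality. The flux is a mean over the
  ordinates, so Cauchy-Schwarz with total weight \<open>2 \<pi>\<close> turns its square into the reserve left by
  \<open>ordinate_dissipation\<close>.
\<close>

lemma coupled_dissipation:
  fixes \<Omega> :: "axis \<Rightarrow> real^'q" and \<Delta> :: "axis \<Rightarrow> real" and w :: "real^'q"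
    and g0 g1 :: "index \<Rightarrow> real^'q" and d :: "index \<Rightarrow> real" and \<epsilon> \<tau> \<sigma> :: real
  assumes per: "periodic M g0" "periodic M g1"
    and w: "\<And>l. w $ l \<ge> 0" "(\<Sum>l\<in>UNIV. w $ l) = 2 * pi"
    and dir: "\<And>l. (\<Omega> Xdir $ l)\<^sup>2 + (\<Omega> Ydir $ l)\<^sup>2 \<le> 1"
    and pos: "\<tau> \<ge> 0" "\<sigma> \<ge> 0" "\<And>v. \<Delta> v > 0"
    and cfl: "\<And>v l. 3 * \<tau> * \<bar>\<Omega> v $ l\<bar> \<le> \<epsilon> * \<Delta> v * \<bar>\<Omega> v $ l\<bar> + \<sigma> * (\<Delta> v)\<^sup>2 / 4"
  shows "0 \<le> (\<Sum>\<kappa>\<in>torus M. 2 * pi * (d \<kappa>)\<^sup>2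
              + 2 * \<tau> * (d \<kappa> * (\<Sum>v\<in>{Xdir, Ydir}. w \<bullet> (Q \<Omega> v *v diff_ctr \<Delta> v g1 \<kappa>))))
          + (\<Sum>\<kappa>\<in>torus M. \<Sum>l\<in>UNIV. w $ l * (\<epsilon>\<^sup>2 * (g1 \<kappa> $ l - g0 \<kappa> $ l)\<^sup>2
              + 2 * \<tau> * \<epsilon> * (g1 \<kappa> $ l * (\<Sum>v\<in>{Xdir, Ydir}. upwind \<Delta> \<Omega> v g0 \<kappa> $ l))
              + 2 * \<tau> * \<sigma> * (g1 \<kappa> $ l)\<^sup>2))"
proof -
  define \<phi> where
    "\<phi> l \<kappa> = (\<Sum>v\<in>{Xdir, Ydir}. \<Omega> v $ l * diff_ctr \<Delta> v (\<lambda>\<kappa>. g1 \<kappa> $ l) \<kappa>)" for l \<kappa>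
  have flux: "(\<Sum>v\<in>{Xdir, Ydir}. w \<bullet> (Q \<Omega> v *v diff_ctr \<Delta> v g1 \<kappa>)) = (\<Sum>l\<in>UNIV. w $ l * \<phi> l \<kappa>)" for \<kappa>
    by (simp add: inner_vec_def Q_def diag_mat_mult_nth diff_ctr_nth \<phi>_def distrib_left sum.distrib)
  have macro: "- (\<tau>\<^sup>2 * (\<Sum>l\<in>UNIV. w $ l * (\<phi> l \<kappa>)\<^sup>2))
      \<le> 2 * pi * (d \<kappa>)\<^sup>2 + 2 * \<tau> * (d \<kappa> * (\<Sum>l\<in>UNIV. w $ l * \<phi> l \<kappa>))" for \<kappa>
  proof -
    define F where "F = (\<Sum>l\<in>UNIV. w $ l * \<phi> l \<kappa>)"
    define W where "W = (\<Sum>l\<in>UNIV. w $ l * (\<phi> l \<kappa>)\<^sup>2)"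
    have "F\<^sup>2 \<le> 2 * pi * W"
      using square_weighted_sum_le[of "\<lambda>l. w $ l" "\<lambda>l. \<phi> l \<kappa>"] w by (simp add: F_def W_def)
    then have "\<tau>\<^sup>2 * F\<^sup>2 \<le> \<tau>\<^sup>2 * (2 * pi * W)"
      by (rule mult_left_mono) simp
    moreover have "0 \<le> (2 * pi * d \<kappa> + \<tau> * F)\<^sup>2"
      by simp
    then have "0 \<le> 2 * pi * (2 * pi * (d \<kappa>)\<^sup>2 + 2 * \<tau> * (d \<kappa> * F)) + \<tau>\<^sup>2 * F\<^sup>2"
      by (simp add: power2_eq_square algebra_simps)
    ultimately have "0 \<le> 2 * pi * (2 * pi * (d \<kappa>)\<^sup>2 + 2 * \<tau> * (d \<kappa> * F)
        + \<tau>\<^sup>2 * W)"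
      by (simp add: algebra_simps)
    then have "0 \<le> 2 * pi * (d \<kappa>)\<^sup>2 + 2 * \<tau> * (d \<kappa> * F) + \<tau>\<^sup>2 * W"
      by (subst (asm) zero_le_mult_iff) (use pi_gt_zero in linarith)
    then show ?thesis
      unfolding F_def W_def by linarith
  qed
  have "- (\<Sum>l\<in>UNIV. w $ l * (\<tau>\<^sup>2 * (\<Sum>\<kappa>\<in>torus M. (\<phi> l \<kappa>)\<^sup>2)))
      = (\<Sum>\<kappa>\<in>torus M. - (\<tau>\<^sup>2 * (\<Sum>l\<in>UNIV. w $ l * (\<phi> l \<kappa>)\<^sup>2)))"
    unfolding sum_distrib_left sum_negf by (subst sum.swap) (simp add: mult.left_commute)
  also have "\<dots> \<le> (\<Sum>\<kappa>\<in>torus M. 2 * pi * (d \<kappa>)\<^sup>2 + 2 * \<tau> * (d \<kappa> * (\<Sum>l\<in>UNIV. w $ l * \<phi> l \<kappa>)))"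
    by (rule sum_mono) (rule macro)
  finally have 1: "- (\<Sum>l\<in>UNIV. w $ l * (\<tau>\<^sup>2 * (\<Sum>\<kappa>\<in>torus M. (\<phi> l \<kappa>)\<^sup>2)))
      \<le> (\<Sum>\<kappa>\<in>torus M. 2 * pi * (d \<kappa>)\<^sup>2 + 2 * \<tau> * (d \<kappa> * (\<Sum>l\<in>UNIV. w $ l * \<phi> l \<kappa>)))" .
  have "(\<Sum>l\<in>UNIV. w $ l * (\<tau>\<^sup>2 * (\<Sum>\<kappa>\<in>torus M. (\<phi> l \<kappa>)\<^sup>2)))
      \<le> (\<Sum>l\<in>UNIV. w $ l * (\<Sum>\<kappa>\<in>torus M. \<epsilon>\<^sup>2 * (g1 \<kappa> $ l - g0 \<kappa> $ l)\<^sup>2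
              + 2 * \<tau> * \<epsilon> * (g1 \<kappa> $ l * (\<Sum>v\<in>{Xdir, Ydir}. upwind \<Delta> \<Omega> v g0 \<kappa> $ l))
              + 2 * \<tau> * \<sigma> * (g1 \<kappa> $ l)\<^sup>2))"
    unfolding \<phi>_def upwind_nth
    by (intro sum_mono mult_left_mono ordinate_dissipation w dir pos cfl periodic_apply[OF per(1)]
        periodic_apply[OF per(2)])
  also have "\<dots> = (\<Sum>\<kappa>\<in>torus M. \<Sum>l\<in>UNIV. w $ l * (\<epsilon>\<^sup>2 * (g1 \<kappa> $ l - g0 \<kappa> $ l)\<^sup>2
              + 2 * \<tau> * \<epsilon> * (g1 \<kappa> $ l * (\<Sum>v\<in>{Xdir, Ydir}. upwind \<Delta> \<Omega> v g0 \<kappa> $ l))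
              + 2 * \<tau> * \<sigma> * (g1 \<kappa> $ l)\<^sup>2))"
    unfolding sum_distrib_left by (rule sum.swap)
  finally show ?thesis
    using 1 unfolding flux by linarith
qed


section \<open>Balance laws at a grid point\<close>

text \<open>
  The tangent to \<open>t\<^sup>5\<close> at \<open>y\<close> lies below the graph on \<open>t \<ge> 0\<close>.
\<close>

lemma power5_tangent_le:
  fixes x y :: real
  assumes "x \<ge> 0" "y \<ge> 0"
  shows "y ^ 5 - x ^ 5 \<le> 5 * y ^ 4 * (y - x)"
proof -
  have "5 * y ^ 4 * (y - x) - (y ^ 5 - x ^ 5)
      = (y - x)\<^sup>2 * (4 * y ^ 3 + 3 * y\<^sup>2 * x + 2 * y * x\<^sup>2 + x ^ 3)"
    by (simp add: algebra_simps eval_nat_numeral)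
  also have "\<dots> \<ge> 0"
    using assms by (intro mult_nonneg_nonneg add_nonneg_nonneg) simp_all
  finally show ?thesis by simp
qed

text \<open>
  The macroscopic equation times \<open>4 \<pi> c \<Delta>t u1\<close>. On its right-hand side the \<open>h\<close> part of \<open>u1\<close> yields a
  square with the good sign, and the \<open>B\<close> part is turned into a temperature increment by the
  temperature equation.
\<close>

lemma macro_balance:
  fixes \<epsilon> c a k \<Delta>t \<sigma> h0 h1 B0 B1 T0 T1 D :: real
  assumes pos: "c > 0" "a > 0" "k > 0" "\<Delta>t > 0" "\<sigma> \<ge> 0" and T: "T0 \<ge> 0" "T1 \<ge> 0"
    and B1: "B1 = a * c / (2 * pi) * T1 ^ 4"
    and meso: "\<epsilon>\<^sup>2 / (c * \<Delta>t) * (h1 - h0) + 1 / (c * \<Delta>t) * (B1 - B0) + 1 / (2 * pi) * D = - \<sigma> * h1"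
    and macro: "k / \<Delta>t * (T1 - T0) = 2 * pi * \<sigma> * h1"
  defines "u0 \<equiv> B0 + \<epsilon>\<^sup>2 * h0" and "u1 \<equiv> B1 + \<epsilon>\<^sup>2 * h1"
  shows "2 * pi * (u1\<^sup>2 - u0\<^sup>2 + (u1 - u0)\<^sup>2) + 2 * (c * \<Delta>t) * (u1 * D)
      + 2 / 5 * (a * c\<^sup>2 * k / (2 * pi)) * (T1 ^ 5 - T0 ^ 5) \<le> 0"
proof -
  have "2 * pi * (c * \<Delta>t) * (\<epsilon>\<^sup>2 / (c * \<Delta>t) * (h1 - h0) + 1 / (c * \<Delta>t) * (B1 - B0) + 1 / (2 * pi) * D)
      = 2 * pi * (u1 - u0) + c * \<Delta>t * D"
    using pos by (simp add: u0_def u1_def field_simps)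
  then have u: "2 * pi * (u1 - u0) + c * \<Delta>t * D = - (c * \<Delta>t * (2 * pi * \<sigma> * h1))"
    unfolding meso by (simp add: mult_ac)
  have "2 * pi * (u1\<^sup>2 - u0\<^sup>2 + (u1 - u0)\<^sup>2) + 2 * (c * \<Delta>t) * (u1 * D)
      = 2 * u1 * (2 * pi * (u1 - u0) + c * \<Delta>t * D)"
    by (simp add: power2_eq_square algebra_simps)
  also have "\<dots> = - 2 * (B1 * (c * \<Delta>t * (2 * pi * \<sigma> * h1))) - 4 * (\<epsilon>\<^sup>2 * c * \<Delta>t * pi * \<sigma> * h1\<^sup>2)"
    unfolding u by (simp add: u1_def power2_eq_square algebra_simps)
  also have "\<dots> \<le> - 2 * (B1 * (c * \<Delta>t * (2 * pi * \<sigma> * h1)))"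
    using pos by simp
  also have "B1 * (c * \<Delta>t * (2 * pi * \<sigma> * h1)) = a * c\<^sup>2 * k / (2 * pi) * (T1 ^ 4 * (T1 - T0))"
    unfolding macro[symmetric] B1 using pos by (simp add: power2_eq_square field_simps)
  finally have "2 * pi * (u1\<^sup>2 - u0\<^sup>2 + (u1 - u0)\<^sup>2) + 2 * (c * \<Delta>t) * (u1 * D)
      \<le> - 2 * (a * c\<^sup>2 * k / (2 * pi) * (T1 ^ 4 * (T1 - T0)))" .
  moreover have "a * c\<^sup>2 * k / (2 * pi) * (T1 ^ 5 - T0 ^ 5)
      \<le> a * c\<^sup>2 * k / (2 * pi) * (5 * (T1 ^ 4 * (T1 - T0)))"
    using power5_tangent_le[OF T] pos by (intro mult_left_mono) (simp_all add: mult.assoc)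
  ultimately show ?thesis
    unfolding mult.assoc[of "2 / 5"] mult.left_commute[of _ 5] by linarith
qed

lemma micro_proj_nth: "(micro_proj w *v x) $ l = x $ l - (w \<bullet> x) / (2 * pi)"
proof -
  have "micro_proj w *v x
      = x - (1 / (2 * pi)) *\<^sub>R (((columnvector 1 :: real^1^'a) ** rowvector w) *v x)"
    unfolding micro_proj_def
    by (simp add: matrix_vector_mult_diff_rdistrib scaleR_matrix_vector_assoc[symmetric])
  moreover have "(((columnvector 1 :: real^1^'a) ** rowvector w) *v x) $ l = w \<bullet> x"
    by (simp add: matrix_vector_mult_def matrix_matrix_mult_def columnvector_def rowvector_def
        inner_vec_def)
  ultimately show ?thesis by simp
qed

text \<open>
  The microscopic equation, tested with \<open>2 c \<Delta>t w g1\<close> and summed over the ordinates. Here \<open>\<delta>\<close> stands for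
  the discrete gradient of \<open>u\<close> and \<open>L\<close> for the upwind terms. The mean of \<open>L\<close> that the projection
  subtracts is constant in the ordinate, hence orthogonal to \<open>g1\<close>.
\<close>

lemma micro_balance:
  fixes \<Omega> :: "axis \<Rightarrow> real^'q" and w g0 g1 L :: "real^'q" and \<delta> :: "axis \<Rightarrow> real"
  assumes pos: "c > 0" "\<Delta>t > 0" and w: "\<And>l. w $ l \<ge> 0" and \<sigma>: "\<sigma>0 \<le> \<sigma>"
    and mean: "w \<bullet> g1 = 0"
    and micro: "(\<epsilon>\<^sup>2 / (c * \<Delta>t)) *\<^sub>R (g1 - g0) + \<epsilon> *\<^sub>R (micro_proj w *v L)
        + (\<Sum>v\<in>{Xdir, Ydir}. \<delta> v *\<^sub>R (Q \<Omega> v *v 1)) = - \<sigma> *\<^sub>R g1"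
  shows "(\<Sum>l\<in>UNIV. w $ l * (\<epsilon>\<^sup>2 * ((g1 $ l)\<^sup>2 - (g0 $ l)\<^sup>2 + (g1 $ l - g0 $ l)\<^sup>2)
            + 2 * (c * \<Delta>t) * \<epsilon> * (g1 $ l * L $ l) + 2 * (c * \<Delta>t) * \<sigma>0 * (g1 $ l)\<^sup>2))
       + 2 * (c * \<Delta>t) * (\<Sum>v\<in>{Xdir, Ydir}. \<delta> v * (w \<bullet> (Q \<Omega> v *v g1))) \<le> 0"
proof -
  define \<tau> where "\<tau> = c * \<Delta>t"
  have \<tau>: "\<tau> > 0" using pos by (simp add: \<tau>_def)
  define m where "m = (w \<bullet> L) / (2 * pi)"
  have comp: "\<epsilon>\<^sup>2 * (g1 $ l - g0 $ l)
      = \<tau> * (- \<sigma> * g1 $ l - \<epsilon> * (L $ l - m) - (\<Sum>v\<in>{Xdir, Ydir}. \<delta> v * \<Omega> v $ l))" for l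
  proof -
    have scaled: "\<epsilon>\<^sup>2 / \<tau> * (g1 $ l - g0 $ l)
        = - \<sigma> * g1 $ l - \<epsilon> * (L $ l - m) - (\<Sum>v\<in>{Xdir, Ydir}. \<delta> v * \<Omega> v $ l)"
      using arg_cong[OF micro[folded \<tau>_def], of "\<lambda>x. x $ l"]
      by (simp add: micro_proj_nth Q_def diag_mat_mult_nth m_def)
    have "\<epsilon>\<^sup>2 * (g1 $ l - g0 $ l) = \<tau> * (\<epsilon>\<^sup>2 / \<tau> * (g1 $ l - g0 $ l))"
      using \<tau> by simp
    then show ?thesis unfolding scaled .
  qed
  have per_ordinate: "w $ l * (\<epsilon>\<^sup>2 * ((g1 $ l)\<^sup>2 - (g0 $ l)\<^sup>2 + (g1 $ l - g0 $ l)\<^sup>2)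
            + 2 * \<tau> * \<epsilon> * (g1 $ l * L $ l) + 2 * \<tau> * \<sigma>0 * (g1 $ l)\<^sup>2)
      \<le> 2 * \<tau> * \<epsilon> * m * (w $ l * g1 $ l)
        - 2 * \<tau> * (\<Sum>v\<in>{Xdir, Ydir}. \<delta> v * (w $ l * (\<Omega> v $ l * g1 $ l)))" for l
  proof -
    have "\<epsilon>\<^sup>2 * ((g1 $ l)\<^sup>2 - (g0 $ l)\<^sup>2 + (g1 $ l - g0 $ l)\<^sup>2)
        = 2 * g1 $ l * (\<epsilon>\<^sup>2 * (g1 $ l - g0 $ l))"
      by (simp add: power2_eq_square algebra_simps)
    also have "\<dots> = 2 * \<tau> * \<epsilon> * m * g1 $ l - 2 * \<tau> * (\<Sum>v\<in>{Xdir, Ydir}. \<delta> v * (\<Omega> v $ l * g1 $ l))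
        - 2 * \<tau> * \<epsilon> * (g1 $ l * L $ l) - 2 * \<tau> * \<sigma> * (g1 $ l)\<^sup>2"
      unfolding comp by (simp add: power2_eq_square algebra_simps)
    finally have eq: "\<epsilon>\<^sup>2 * ((g1 $ l)\<^sup>2 - (g0 $ l)\<^sup>2 + (g1 $ l - g0 $ l)\<^sup>2) = \<dots>" .
    have "2 * \<tau> * \<sigma>0 * (g1 $ l)\<^sup>2 \<le> 2 * \<tau> * \<sigma> * (g1 $ l)\<^sup>2"
      using \<sigma> \<tau> by (intro mult_right_mono mult_left_mono) simp_all
    with eq have "\<epsilon>\<^sup>2 * ((g1 $ l)\<^sup>2 - (g0 $ l)\<^sup>2 + (g1 $ l - g0 $ l)\<^sup>2)
            + 2 * \<tau> * \<epsilon> * (g1 $ l * L $ l) + 2 * \<tau> * \<sigma>0 * (g1 $ l)\<^sup>2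
        \<le> 2 * \<tau> * \<epsilon> * m * g1 $ l - 2 * \<tau> * (\<Sum>v\<in>{Xdir, Ydir}. \<delta> v * (\<Omega> v $ l * g1 $ l))"
      by linarith
    from mult_left_mono[OF this w[of l]] show ?thesis
      by (simp add: algebra_simps)
  qed
  have "(\<Sum>l\<in>UNIV. w $ l * (\<epsilon>\<^sup>2 * ((g1 $ l)\<^sup>2 - (g0 $ l)\<^sup>2 + (g1 $ l - g0 $ l)\<^sup>2)
            + 2 * \<tau> * \<epsilon> * (g1 $ l * L $ l) + 2 * \<tau> * \<sigma>0 * (g1 $ l)\<^sup>2))
      \<le> (\<Sum>l\<in>UNIV. 2 * \<tau> * \<epsilon> * m * (w $ l * g1 $ l)
        - 2 * \<tau> * (\<Sum>v\<in>{Xdir, Ydir}. \<delta> v * (w $ l * (\<Omega> v $ l * g1 $ l))))"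
    by (rule sum_mono) (rule per_ordinate)
  also have "\<dots> = 2 * \<tau> * \<epsilon> * m * (w \<bullet> g1)
        - 2 * \<tau> * (\<Sum>v\<in>{Xdir, Ydir}. \<delta> v * (w \<bullet> (Q \<Omega> v *v g1)))"
    by (simp add: inner_vec_def Q_def diag_mat_mult_nth sum_subtractf sum.distrib sum_distrib_left
        distrib_left)
  finally show ?thesis
    by (simp add: mean \<tau>_def)
qed


section \<open>Periodic extension of the fields\<close>

text \<open>
  In the Dirichlet case the period is one cell longer than the rectangle. The indices \<open>2..2N\<close> carry
  unknowns, so the three zero columns \<open>2N + 1\<close>, \<open>2N + 2\<close> and \<open>1\<close> (modulo \<open>2N + 2\<close>) separate two copies,
  and a stencil reaching two half steps from an unknown stays within its own copy.
\<close>

fun torus_cells :: "bc \<Rightarrow> (axis \<Rightarrow> nat) \<Rightarrow> axis \<Rightarrow> nat" where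
  "torus_cells Periodic N v = N v"
| "torus_cells Zero_Dirichlet N v = N v + 1"

definition wrap :: "(axis \<Rightarrow> nat) \<Rightarrow> index \<Rightarrow> index" where
  "wrap M = (\<lambda>(p, q). ((p - 1) mod (2 * int (M Xdir)) + 1, (q - 1) mod (2 * int (M Ydir)) + 1))"

text \<open>
  The extension also annihilates the field on the complement of the lattice \<open>K\<close>, where its values
  are meaningless. Sums over \<open>centers\<close> and over \<open>interfaces\<close> thereby become sums over the whole
  torus, which a half step maps to itself.
\<close>

definition torus_ext ::
  "bc \<Rightarrow> (axis \<Rightarrow> nat) \<Rightarrow> index set \<Rightarrow> (index \<Rightarrow> 'a::zero) \<Rightarrow> index \<Rightarrow> 'a" where
  "torus_ext b N K u \<kappa> =
     (if wrap (torus_cells b N) \<kappa> \<in> K \<inter> unknowns b N then u (wrap (torus_cells b N) \<kappa>) else 0)"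

lemma periodic_wrap: "periodic M (wrap M)"
proof -
  have "(p + m - 1) mod m = (p - 1) mod m" for p m :: int
    by (metis add_diff_eq diff_add_eq mod_add_self2)
  then show ?thesis
    by (auto simp: periodic_def wrap_def plus_prod_def)
qed

lemma periodic_torus_ext: "periodic (torus_cells b N) (torus_ext b N K u)"
  using periodic_wrap[of "torus_cells b N"] unfolding periodic_def torus_ext_def by simp

lemma wrap_torus: "\<kappa> \<in> torus M \<Longrightarrow> wrap M \<kappa> = \<kappa>"
  by (auto simp: torus_def wrap_def)

lemma unknowns_subset_torus: "unknowns b N \<subseteq> torus (torus_cells b N)"
  by (cases b) (auto simp: torus_def)

lemma torus_ext_on_torus:
  "\<kappa> \<in> torus (torus_cells b N) \<Longrightarrow>
     torus_ext b N K u \<kappa> = (if \<kappa> \<in> K \<inter> unknowns b N then u \<kappa> else 0)"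
  by (simp add: torus_ext_def wrap_torus)

lemma torus_ext_on_unknowns:
  "\<kappa> \<in> K \<inter> unknowns b N \<Longrightarrow> torus_ext b N K u \<kappa> = u \<kappa>"
  using unknowns_subset_torus[of b N] by (auto simp: torus_ext_on_torus)

lemma sum_torus_eq_unknowns:
  fixes F :: "index \<Rightarrow> real"
  assumes "\<And>\<kappa>. \<kappa> \<in> torus (torus_cells b N) \<Longrightarrow> \<kappa> \<notin> K \<inter> unknowns b N \<Longrightarrow> F \<kappa> = 0"
  shows "sum F (torus (torus_cells b N)) = sum F (K \<inter> unknowns b N)"
  using assms unknowns_subset_torus[of b N] by (intro sum.mono_neutral_right) (auto simp: torus_def)

text \<open>
  Membership depends on the parities of the two coordinates only. Periods are even, so wrapping
  around the torus respects such a lattice.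
\<close>

definition even_invariant :: "index set \<Rightarrow> bool" where
  "even_invariant K \<longleftrightarrow> (\<forall>p q i j. (p + 2 * i, q + 2 * j) \<in> K \<longleftrightarrow> (p, q) \<in> K)"

lemma even_invariant_grids: "even_invariant centers" "even_invariant interfaces"
  by (auto simp: even_invariant_def centers_def interfaces_def)

lemma even_invariant_wrap:
  assumes "even_invariant K"
  shows "wrap M \<kappa> \<in> K \<longleftrightarrow> \<kappa> \<in> K"
proof (cases \<kappa>)
  case (Pair p q)
  let ?m = "2 * int (M Xdir)" and ?n = "2 * int (M Ydir)"
  have "p = (p - 1) mod ?m + 1 + 2 * (int (M Xdir) * ((p - 1) div ?m))"
    and "q = (q - 1) mod ?n + 1 + 2 * (int (M Ydir) * ((q - 1) div ?n))"
    using mult_div_mod_eq[of ?m "p - 1"] mult_div_mod_eq[of ?n "q - 1"] by linarith+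
  then show ?thesis
    using assms unfolding Pair even_invariant_def wrap_def by (metis case_prod_conv)
qed

text \<open>
  The boundary condition states invariance under one period and on the lattice only; wrapping may
  require several periods, and every intermediate point has to stay in the lattice.
\<close>

lemma periodic_on_wrap:
  assumes K: "even_invariant K" and bc: "satisfies_bc Periodic N K u" and \<kappa>: "\<kappa> \<in> K"
  shows "u (wrap N \<kappa>) = u \<kappa>"
proof -
  let ?m = "2 * int (N Xdir)" and ?n = "2 * int (N Ydir)"
  have inv: "(p + 2 * i, q + 2 * j) \<in> K" if "(p, q) \<in> K" for p q i j
    using K that by (simp add: even_invariant_def)
  have step: "u (p + ?m, q) = u (p, q)" "u (p, q + ?n) = u (p, q)" if "(p, q) \<in> K" for p q
    using bc that by auto
  have x: "u (p + ?m * k, q) = u (p, q)" if pq: "(p, q) \<in> K" for p q k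
  proof (induction k rule: int_induct[of _ 0])
    case (step1 k)
    have "(p + ?m * k, q) \<in> K"
      using inv[OF pq, of "int (N Xdir) * k" 0] by (simp add: mult.assoc)
    from step(1)[OF this] step1 show ?case by (simp add: algebra_simps)
  next
    case (step2 k)
    have "(p + ?m * (k - 1), q) \<in> K"
      using inv[OF pq, of "int (N Xdir) * (k - 1)" 0] by (simp add: mult.assoc)
    from step(1)[OF this] step2 show ?case by (simp add: algebra_simps)
  qed simp
  have y: "u (p, q + ?n * k) = u (p, q)" if pq: "(p, q) \<in> K" for p q k
  proof (induction k rule: int_induct[of _ 0])
    case (step1 k)
    have "(p, q + ?n * k) \<in> K"
      using inv[OF pq, of 0 "int (N Ydir) * k"] by (simp add: mult.assoc)
    from step(2)[OF this] step1 show ?case by (simp add: algebra_simps)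
  next
    case (step2 k)
    have "(p, q + ?n * (k - 1)) \<in> K"
      using inv[OF pq, of 0 "int (N Ydir) * (k - 1)"] by (simp add: mult.assoc)
    from step(2)[OF this] step2 show ?case by (simp add: algebra_simps)
  qed simp
  obtain p q where pq: "\<kappa> = (p, q)" by (cases \<kappa>)
  define p' q' where "p' = (p - 1) mod ?m + 1" and "q' = (q - 1) mod ?n + 1"
  have p: "p = p' + ?m * ((p - 1) div ?m)" and q: "q = q' + ?n * ((q - 1) div ?n)"
    using mult_div_mod_eq[of ?m "p - 1"] mult_div_mod_eq[of ?n "q - 1"]
    unfolding p'_def q'_def by linarith+
  have K': "(p', q') \<in> K"
    using even_invariant_wrap[OF K, of N \<kappa>] \<kappa> by (simp add: pq wrap_def p'_def q'_def)
  have "(p', q) \<in> K"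
    using inv[OF K', of 0 "int (N Ydir) * ((q - 1) div ?n)"] q by (simp add: mult.assoc)
  then have "u (p, q) = u (p', q)"
    using x[of p' q "(p - 1) div ?m"] p by simp
  also have "\<dots> = u (p', q')"
    using y[OF K', of "(q - 1) div ?n"] q by simp
  finally show ?thesis by (simp add: pq wrap_def p'_def q'_def)
qed

text \<open>
  The extended fields satisfy the scheme wherever it is imposed, because the stencils reach at
  most two half steps.
\<close>

lemma torus_ext_near_unknowns:
  assumes K: "even_invariant K" and bc: "satisfies_bc b N K u" and N: "\<And>v. N v \<ge> 1"
    and \<kappa>: "\<kappa> \<in> unknowns b N" and s: "\<bar>fst s\<bar> \<le> 2" "\<bar>snd s\<bar> \<le> 2" and K': "\<kappa> + s \<in> K"
  shows "torus_ext b N K u (\<kappa> + s) = u (\<kappa> + s)"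
proof (cases b)
  case Periodic
  have M: "torus_cells b N = N" using Periodic by (auto simp: fun_eq_iff)
  have mod_range: "0 \<le> r mod (2 * int (N v)) \<and> r mod (2 * int (N v)) < 2 * int (N v)" for r v
    using N[of v] by simp
  have "wrap N (\<kappa> + s) \<in> unknowns b N"
    using mod_range[of "fst \<kappa> + fst s - 1" Xdir] mod_range[of "snd \<kappa> + snd s - 1" Ydir] Periodic
    by (simp add: wrap_def case_prod_unfold add.commute zle_add1_eq_le)
  moreover have "wrap N (\<kappa> + s) \<in> K"
    using even_invariant_wrap[OF K] K' by blast
  moreover have "u (wrap N (\<kappa> + s)) = u (\<kappa> + s)"
    using periodic_on_wrap[OF K _ K'] bc Periodic by blast
  ultimately show ?thesis
    unfolding torus_ext_def M by simp
next
  case Zero_Dirichlet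
  obtain p q where pq: "\<kappa> + s = (p, q)" by (cases "\<kappa> + s")
  have range: "0 \<le> p" "p \<le> 2 * int (N Xdir) + 2" "0 \<le> q" "q \<le> 2 * int (N Ydir) + 2"
    using \<kappa> s arg_cong[OF pq, of fst] arg_cong[OF pq, of snd] Zero_Dirichlet by auto
  have wrap_coord: "(r - 1) mod (2 * int n + 2) + 1 = (if r = 0 then 2 * int n + 2 else r)"
    if "0 \<le> r" "r \<le> 2 * int n + 2" for r :: int and n
  proof (cases "r = 0")
    case True
    then show ?thesis by (simp add: zmod_minus1)
  qed (use that in simp)
  have w: "wrap (torus_cells b N) (p, q)
      = (if p = 0 then 2 * int (N Xdir) + 2 else p, if q = 0 then 2 * int (N Ydir) + 2 else q)"
    using wrap_coord[OF range(1,2)] wrap_coord[OF range(3,4)] Zero_Dirichlet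
    by (simp add: wrap_def algebra_simps)
  show ?thesis
  proof (cases "(p, q) \<in> unknowns b N")
    case True
    then show ?thesis
      using torus_ext_on_unknowns[of "(p, q)" K b N u] K' by (simp add: pq)
  next
    case False
    then have "wrap (torus_cells b N) (p, q) \<notin> unknowns b N"
      unfolding w using Zero_Dirichlet by auto
    moreover have "u (p, q) = 0"
      using bc K' False Zero_Dirichlet by (simp add: pq)
    ultimately show ?thesis by (simp add: torus_ext_def pq)
  qed
qed

lemma diff_ctr_torus_ext:
  assumes "even_invariant K" "satisfies_bc b N K u" "\<And>v. N v \<ge> 1" "\<kappa> \<in> unknowns b N"
    and K: "\<kappa> + unit_step v \<in> K" "\<kappa> - unit_step v \<in> K"
  shows "diff_ctr \<Delta> v (torus_ext b N K u) \<kappa> = diff_ctr \<Delta> v u \<kappa>"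
proof -
  note near = torus_ext_near_unknowns[OF assms(1-4)]
  have "torus_ext b N K u (\<kappa> + unit_step v) = u (\<kappa> + unit_step v)"
    by (rule near) (cases v; simp; fail | rule K)+
  moreover have "torus_ext b N K u (\<kappa> + (- unit_step v)) = u (\<kappa> + (- unit_step v))"
    by (rule near) (cases v; simp; fail | use K(2) in simp)+
  ultimately show ?thesis
    by (simp add: diff_ctr_def)
qed

lemma upwind_torus_ext:
  assumes "even_invariant K" "satisfies_bc b N K g" "\<And>v. N v \<ge> 1" and \<kappa>: "\<kappa> \<in> K \<inter> unknowns b N"
    and K: "\<kappa> + (unit_step v + unit_step v) \<in> K" "\<kappa> - (unit_step v + unit_step v) \<in> K"
  shows "upwind \<Delta> \<Omega> v (torus_ext b N K g) \<kappa> = upwind \<Delta> \<Omega> v g \<kappa>"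
proof -
  have "\<kappa> \<in> unknowns b N" using \<kappa> by simp
  note near = torus_ext_near_unknowns[OF assms(1-3) this]
  have "torus_ext b N K g (\<kappa> + (unit_step v + unit_step v)) = g (\<kappa> + (unit_step v + unit_step v))"
    by (rule near) (cases v; simp; fail | rule K)+
  moreover have "torus_ext b N K g (\<kappa> + (- (unit_step v + unit_step v)))
      = g (\<kappa> + (- (unit_step v + unit_step v)))"
    by (rule near) (cases v; simp; fail | use K(2) in \<open>simp only: diff_conv_add_uminus\<close>)+
  ultimately show ?thesis
    using torus_ext_on_unknowns[OF \<kappa>, of g]
    by (simp only: upwind_def diff_fwd_def diff_bwd_def diff_conv_add_uminus minus_add_distrib add.assoc)
qed

lemma staggered_neighbours:
  "\<kappa> \<in> interfaces \<Longrightarrow> \<kappa> + unit_step v \<in> centers"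
  "\<kappa> \<in> interfaces \<Longrightarrow> \<kappa> - unit_step v \<in> centers"
  "\<kappa> \<in> centers \<Longrightarrow> \<kappa> + unit_step v \<in> interfaces"
  "\<kappa> \<in> centers \<Longrightarrow> \<kappa> - unit_step v \<in> interfaces"
  "\<kappa> \<in> interfaces \<Longrightarrow> \<kappa> + (unit_step v + unit_step v) \<in> interfaces"
  "\<kappa> \<in> interfaces \<Longrightarrow> \<kappa> - (unit_step v + unit_step v) \<in> interfaces"
  by (cases v; auto simp: centers_def interfaces_def)+

lemma position_in_rectangle:
  assumes "\<And>v. N v \<ge> 1" "\<And>v. lo v < hi v" "\<And>v. \<Delta> v = (hi v - lo v) / real (N v)"
    and "\<kappa> \<in> unknowns b N"
  shows "position lo \<Delta> \<kappa> \<in> {lo Xdir..hi Xdir} \<times> {lo Ydir..hi Ydir}"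
proof -
  have coord: "lo v + (real_of_int p - 1) / 2 * \<Delta> v \<in> {lo v..hi v}"
    if p: "1 \<le> p" "p \<le> 2 * int (N v)" for v p
  proof -
    have "\<Delta> v > 0" and hi: "hi v = lo v + real (N v) * \<Delta> v"
      using assms(1)[of v] assms(2)[of v] unfolding assms(3) by auto
    have "0 \<le> (real_of_int p - 1) / 2" "(real_of_int p - 1) / 2 \<le> real (N v)"
      using p of_int_le_iff[of p "2 * int (N v)", where 'a = real] by simp_all
    then show ?thesis
      unfolding hi using \<open>\<Delta> v > 0\<close> by (auto intro: mult_right_mono less_imp_le)
  qed
  have "1 \<le> fst \<kappa>" "fst \<kappa> \<le> 2 * int (N Xdir)" "1 \<le> snd \<kappa>" "snd \<kappa> \<le> 2 * int (N Ydir)"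
    using assms(4) by (cases b; auto)+
  from coord[OF this(1,2)] coord[OF this(3,4)] show ?thesis
    by (simp add: position_def case_prod_unfold)
qed

text \<open>
  In the scaling \<open>2 \<pi> c\<^sup>2 / (\<Delta>x \<Delta>y)\<close> the weights of the energy are those of the balance laws.
\<close>

lemma energy_eq_scaled_sum:
  assumes pos: "c > 0" "a > 0" "k > 0" and T: "\<And>\<kappa>. \<kappa> \<in> centers \<Longrightarrow> T \<kappa> \<ge> 0"
  shows "energy \<epsilon> c a k \<Delta> D w g h T = \<Delta> Xdir * \<Delta> Ydir / (2 * pi * c\<^sup>2) *
     (2 * pi * (\<Sum>\<kappa>\<in>centers \<inter> D. (planck a c T \<kappa> + \<epsilon>\<^sup>2 * h \<kappa>)\<^sup>2)
      + \<epsilon>\<^sup>2 * (\<Sum>\<kappa>\<in>interfaces \<inter> D. \<Sum>l\<in>UNIV. w $ l * (g \<kappa> $ l)\<^sup>2)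
      + 2 / 5 * (a * c\<^sup>2 * k / (2 * pi)) * (\<Sum>\<kappa>\<in>centers \<inter> D. T \<kappa> ^ 5))"
proof -
  have u: "sqnorm_C \<Delta> D (\<lambda>\<kappa>. 1 / c * planck a c T \<kappa> + \<epsilon>\<^sup>2 / c * h \<kappa>)
      = \<Delta> Xdir * \<Delta> Ydir / c\<^sup>2 * (\<Sum>\<kappa>\<in>centers \<inter> D. (planck a c T \<kappa> + \<epsilon>\<^sup>2 * h \<kappa>)\<^sup>2)"
  proof -
    have "1 / c * planck a c T \<kappa> + \<epsilon>\<^sup>2 / c * h \<kappa> = (planck a c T \<kappa> + \<epsilon>\<^sup>2 * h \<kappa>) / c" for \<kappa>
      by (simp add: add_divide_distrib)
    then show ?thesis
      unfolding sqnorm_C_def sum_distrib_left by (simp add: power_divide mult.commute)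
  qed
  have g: "sqnorm_I \<Delta> D w (\<lambda>\<kappa>. (\<epsilon> / c) *\<^sub>R g \<kappa>)
      = \<Delta> Xdir * \<Delta> Ydir / c\<^sup>2 * (\<epsilon>\<^sup>2 * (\<Sum>\<kappa>\<in>interfaces \<inter> D. \<Sum>l\<in>UNIV. w $ l * (g \<kappa> $ l)\<^sup>2))"
    unfolding sqnorm_I_def sum_distrib_left
    by (intro sum.cong refl) (simp add: power_mult_distrib power_divide)
  have powr: "(t powr (5 / 2))\<^sup>2 = t ^ 5" if "t \<ge> 0" for t :: real
  proof (cases "t = 0")
    case False
    then have "(t powr (5 / 2))\<^sup>2 = t powr (real 5)"
      by (simp add: power2_eq_square powr_add[symmetric])
    also have "\<dots> = t ^ 5"
      using that False by (subst powr_realpow) simp_all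
    finally show ?thesis .
  qed simp
  have T: "sqnorm_C \<Delta> D (\<lambda>\<kappa>. sqrt (a * k) / (2 * pi) * T \<kappa> powr (5 / 2))
      = \<Delta> Xdir * \<Delta> Ydir / c\<^sup>2 * (a * c\<^sup>2 * k / (2 * pi)\<^sup>2 * (\<Sum>\<kappa>\<in>centers \<inter> D. T \<kappa> ^ 5))"
    unfolding sqnorm_C_def sum_distrib_left
    by (intro sum.cong refl) (use pos T in \<open>simp add: power_mult_distrib power_divide powr\<close>)
  have "S / c\<^sup>2 * X + 1 / (2 * pi) * (S / c\<^sup>2 * Y) + 2 / 5 * (S / c\<^sup>2 * (a * c\<^sup>2 * k / (2 * pi)\<^sup>2 * Z))
      = S / (2 * pi * c\<^sup>2) * (2 * pi * X + Y + 2 / 5 * (a * c\<^sup>2 * k / (2 * pi)) * Z)" for S X Y Z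
    by (simp add: distrib_left power2_eq_square)
  then show ?thesis
    unfolding energy_def u g T .
qed


section \<open>Energy stability\<close>

lemma satisfies_bc_combine:
  assumes "satisfies_bc b N K u" "satisfies_bc b N K u'" "f 0 0 = 0"
  shows "satisfies_bc b N K (\<lambda>\<kappa>. f (u \<kappa>) (u' \<kappa>))"
  using assms by (cases b) (simp_all add: case_prod_unfold)

lemma flux_diff_ctr:
  "w \<bullet> (Q \<Omega> v *v diff_ctr \<Delta> v g \<kappa>) = diff_ctr \<Delta> v (\<lambda>\<kappa>. w \<bullet> (Q \<Omega> v *v g \<kappa>)) \<kappa>"
  by (simp add: diff_ctr_def matrix_vector_mult_diff_distrib matrix_vector_mult_scaleR inner_diff_right)

theorem theorem3:
  fixes \<epsilon> c a c\<^sub>\<nu> \<Delta>t :: real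
    and \<sigma>a \<sigma>s \<sigma>t :: "real \<times> real \<Rightarrow> real" and \<sigma>a0 \<sigma>t0 :: real
    and lo hi \<Delta> :: "axis \<Rightarrow> real" and N :: "axis \<Rightarrow> nat" and b :: bc
    and w :: "real^('p::finite \<times> 'r::finite)" and \<Omega> :: "axis \<Rightarrow> real^('p \<times> 'r)"
    and g :: "nat \<Rightarrow> index \<Rightarrow> real^('p \<times> 'r)"
    and h T B :: "nat \<Rightarrow> index \<Rightarrow> real" and n :: nat
  assumes constants_pos: "\<epsilon> > 0" "c > 0" "a > 0" "c\<^sub>\<nu> > 0" "\<Delta>t > 0"
    and grid: "\<And>v. lo v < hi v" "\<And>v. N v \<ge> 1" "\<And>v. \<Delta> v = (hi v - lo v) / real (N v)"
    and sigma_t: "\<And>x. \<sigma>t x = \<sigma>a x + \<sigma>s x"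
    and sigma_a_bound: "\<sigma>a0 > 0"
      "\<And>x. x \<in> {lo Xdir..hi Xdir} \<times> {lo Ydir..hi Ydir} \<Longrightarrow> \<sigma>a x \<ge> \<sigma>a0"
    and sigma_t_bound: "\<sigma>t0 > 0"
      "\<And>x. x \<in> {lo Xdir..hi Xdir} \<times> {lo Ydir..hi Ydir} \<Longrightarrow> \<sigma>t x \<ge> \<sigma>t0"
    and quadrature: "tensor_gauss_legendre w \<Omega>"
    and B_def: "\<And>m. B m = planck a c (T m)"
    and T_nonneg: "\<And>m \<kappa>. m \<in> {n, Suc n} \<Longrightarrow> \<kappa> \<in> centers \<Longrightarrow> T m \<kappa> \<ge> 0"
    and zero_mean: "\<And>m \<kappa>. m \<in> {n, Suc n} \<Longrightarrow> \<kappa> \<in> interfaces \<Longrightarrow> w \<bullet> g m \<kappa> = 0"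
    and boundary: "\<And>m. m \<in> {n, Suc n} \<Longrightarrow>
        satisfies_bc b N interfaces (g m) \<and> satisfies_bc b N centers (h m)
        \<and> satisfies_bc b N centers (T m)"
    and micro: "\<And>\<kappa>. \<kappa> \<in> interfaces \<inter> unknowns b N \<Longrightarrow>
        (\<epsilon>\<^sup>2 / (c * \<Delta>t)) *\<^sub>R (g (Suc n) \<kappa> - g n \<kappa>)
        + \<epsilon> *\<^sub>R (micro_proj w *v (upwind \<Delta> \<Omega> Xdir (g n) \<kappa> + upwind \<Delta> \<Omega> Ydir (g n) \<kappa>))
        + (\<Sum>v\<in>{Xdir, Ydir}. diff_ctr \<Delta> v (\<lambda>\<kappa>'. B n \<kappa>' + \<epsilon>\<^sup>2 * h n \<kappa>') \<kappa> *\<^sub>R (Q \<Omega> v *v 1))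
        = - \<sigma>t (position lo \<Delta> \<kappa>) *\<^sub>R g (Suc n) \<kappa>"
    and meso: "\<And>\<kappa>. \<kappa> \<in> centers \<inter> unknowns b N \<Longrightarrow>
        \<epsilon>\<^sup>2 / (c * \<Delta>t) * (h (Suc n) \<kappa> - h n \<kappa>)
        + 1 / (c * \<Delta>t) * (B (Suc n) \<kappa> - B n \<kappa>)
        + 1 / (2 * pi) * (\<Sum>v\<in>{Xdir, Ydir}. w \<bullet> (Q \<Omega> v *v diff_ctr \<Delta> v (g (Suc n)) \<kappa>))
        = - \<sigma>a (position lo \<Delta> \<kappa>) * h (Suc n) \<kappa>"
    and macro: "\<And>\<kappa>. \<kappa> \<in> centers \<inter> unknowns b N \<Longrightarrow>
        c\<^sub>\<nu> / \<Delta>t * (T (Suc n) \<kappa> - T n \<kappa>)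
        = 2 * pi * \<sigma>a (position lo \<Delta> \<kappa>) * h (Suc n) \<kappa>"
    and CFL: "\<And>v l. \<Omega> v $ l \<noteq> 0 \<Longrightarrow>
        \<Delta>t \<le> 1 / (3 * c) * (\<epsilon> * \<Delta> v + \<sigma>t0 * (\<Delta> v)\<^sup>2 / (4 * \<bar>\<Omega> v $ l\<bar>))"
  shows "energy \<epsilon> c a c\<^sub>\<nu> \<Delta> (unknowns b N) w (g (Suc n)) (h (Suc n)) (T (Suc n))
       \<le> energy \<epsilon> c a c\<^sub>\<nu> \<Delta> (unknowns b N) w (g n) (h n) (T n)"
proof -
  define M where "M = torus_cells b N"
  define A where "A = centers \<inter> unknowns b N"
  define J where "J = interfaces \<inter> unknowns b N"
  define u where "u m \<kappa> = B m \<kappa> + \<epsilon>\<^sup>2 * h m \<kappa>" for m \<kappa>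
  define U where "U m = torus_ext b N centers (u m)" for m
  define G where "G m = torus_ext b N interfaces (g m)" for m
  define \<tau> where "\<tau> = c * \<Delta>t"
  define \<theta> where "\<theta> = a * c\<^sup>2 * c\<^sub>\<nu> / (2 * pi)"
  define flux where "flux \<kappa> = (\<Sum>v\<in>{Xdir, Ydir}. w \<bullet> (Q \<Omega> v *v diff_ctr \<Delta> v (G (Suc n)) \<kappa>))" for \<kappa>
  \<comment> \<open>What remains of the tested microscopic equation once the increment of the energy and the
    gradient of \<open>U n\<close> are taken out.\<close>
  define micro_rest where "micro_rest \<kappa> = (\<Sum>l\<in>UNIV. w $ l * (\<epsilon>\<^sup>2 * (G (Suc n) \<kappa> $ l - G n \<kappa> $ l)\<^sup>2
      + 2 * \<tau> * \<epsilon> * (G (Suc n) \<kappa> $ l * (\<Sum>v\<in>{Xdir, Ydir}. upwind \<Delta> \<Omega> v (G n) \<kappa> $ l))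
      + 2 * \<tau> * \<sigma>t0 * (G (Suc n) \<kappa> $ l)\<^sup>2))" for \<kappa>
  define grad where
    "grad \<kappa> = (\<Sum>v\<in>{Xdir, Ydir}. diff_ctr \<Delta> v (U n) \<kappa> * (w \<bullet> (Q \<Omega> v *v G (Suc n) \<kappa>)))" for \<kappa>
  define mass where "mass m \<kappa> = (\<Sum>l\<in>UNIV. w $ l * (G m \<kappa> $ l)\<^sup>2)" for m \<kappa>
  note quad = tensor_gauss_legendre_bounds[OF quadrature]
  have \<Delta>_pos: "\<Delta> v > 0" for v
    using grid(1)[of v] grid(2)[of v] by (simp add: grid(3))
  have \<tau>_pos: "\<tau> > 0" using constants_pos by (simp add: \<tau>_def)
  have times: "n \<in> {n, Suc n}" "Suc n \<in> {n, Suc n}" by auto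

  have bc_u: "satisfies_bc b N centers (u m)" if "m \<in> {n, Suc n}" for m
    using satisfies_bc_combine[of b N centers "T m" "h m" "\<lambda>t x. a * c / (2 * pi) * t ^ 4 + \<epsilon>\<^sup>2 * x"]
      boundary[OF that] by (simp add: u_def[abs_def] B_def planck_def)
  have bc_g: "satisfies_bc b N interfaces (g m)" if "m \<in> {n, Suc n}" for m
    using boundary[OF that] by blast
  have per: "periodic M (U m)" "periodic M (G m)" for m
    unfolding M_def U_def G_def by (rule periodic_torus_ext)+
  have U_A: "U m \<kappa> = u m \<kappa>" if "\<kappa> \<in> A" for m \<kappa>
    unfolding U_def using that by (intro torus_ext_on_unknowns) (simp add: A_def)
  have G_J: "G m \<kappa> = g m \<kappa>" if "\<kappa> \<in> J" for m \<kappa>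
    unfolding G_def using that by (intro torus_ext_on_unknowns) (simp add: J_def)
  have U_off: "U m \<kappa> = 0" if "\<kappa> \<in> torus M" "\<kappa> \<notin> A" for m \<kappa>
    using that by (auto simp: U_def M_def A_def torus_ext_on_torus)
  have G_off: "G m \<kappa> = 0" if "\<kappa> \<in> torus M" "\<kappa> \<notin> J" for m \<kappa>
    using that by (auto simp: G_def M_def J_def torus_ext_on_torus)
  have on_A: "sum F (torus M) = sum F A" if "\<And>\<kappa>. \<kappa> \<in> torus M \<Longrightarrow> \<kappa> \<notin> A \<Longrightarrow> F \<kappa> = 0"
    for F :: "index \<Rightarrow> real"
    using that unfolding M_def A_def by (rule sum_torus_eq_unknowns)
  have on_J: "sum F (torus M) = sum F J" if "\<And>\<kappa>. \<kappa> \<in> torus M \<Longrightarrow> \<kappa> \<notin> J \<Longrightarrow> F \<kappa> = 0"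
    for F :: "index \<Rightarrow> real"
    using that unfolding M_def J_def by (rule sum_torus_eq_unknowns)

  \<comment> \<open>The balance laws hold at the unknowns, and at all other points of the torus their terms vanish.\<close>
  have macro_sum: "(\<Sum>\<kappa>\<in>torus M. 2 * pi * ((U (Suc n) \<kappa>)\<^sup>2 - (U n \<kappa>)\<^sup>2 + (U (Suc n) \<kappa> - U n \<kappa>)\<^sup>2)
        + 2 * \<tau> * (U (Suc n) \<kappa> * flux \<kappa>))
      + 2 / 5 * \<theta> * (\<Sum>\<kappa>\<in>A. T (Suc n) \<kappa> ^ 5 - T n \<kappa> ^ 5) \<le> 0"
  proof -
    have "2 * pi * ((U (Suc n) \<kappa>)\<^sup>2 - (U n \<kappa>)\<^sup>2 + (U (Suc n) \<kappa> - U n \<kappa>)\<^sup>2)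
        + 2 * \<tau> * (U (Suc n) \<kappa> * flux \<kappa>) + 2 / 5 * \<theta> * (T (Suc n) \<kappa> ^ 5 - T n \<kappa> ^ 5) \<le> 0"
      if \<kappa>: "\<kappa> \<in> A" for \<kappa>
    proof -
      have \<kappa>': "\<kappa> \<in> centers" "\<kappa> \<in> unknowns b N" "\<kappa> \<in> centers \<inter> unknowns b N"
        using \<kappa> by (auto simp: A_def)
      have "diff_ctr \<Delta> v (G (Suc n)) \<kappa> = diff_ctr \<Delta> v (g (Suc n)) \<kappa>" for v
        unfolding G_def
        by (intro diff_ctr_torus_ext even_invariant_grids bc_g times grid(2) \<kappa>' staggered_neighbours)
      then have flux: "flux \<kappa> = (\<Sum>v\<in>{Xdir, Ydir}. w \<bullet> (Q \<Omega> v *v diff_ctr \<Delta> v (g (Suc n)) \<kappa>))"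
        by (simp add: flux_def)
      have \<sigma>a: "\<sigma>a (position lo \<Delta> \<kappa>) \<ge> 0"
        using sigma_a_bound(2)[OF position_in_rectangle[OF grid(2,1,3) \<kappa>'(2)]] sigma_a_bound(1)
        by linarith
      show ?thesis
        unfolding U_A[OF \<kappa>] u_def \<tau>_def \<theta>_def flux
        by (rule macro_balance[OF constants_pos(2,3,4,5) \<sigma>a _ _ _ meso[OF \<kappa>'(3)] macro[OF \<kappa>'(3)]])
           (use T_nonneg times \<kappa>' in \<open>simp_all add: B_def planck_def\<close>)
    qed
    then have "(\<Sum>\<kappa>\<in>A. 2 * pi * ((U (Suc n) \<kappa>)\<^sup>2 - (U n \<kappa>)\<^sup>2 + (U (Suc n) \<kappa> - U n \<kappa>)\<^sup>2)
        + 2 * \<tau> * (U (Suc n) \<kappa> * flux \<kappa>) + 2 / 5 * \<theta> * (T (Suc n) \<kappa> ^ 5 - T n \<kappa> ^ 5)) \<le> 0"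
      by (rule sum_nonpos)
    then show ?thesis
      by (subst on_A) (simp_all add: U_off sum.distrib sum_distrib_left)
  qed

  have micro_sum: "(\<Sum>\<kappa>\<in>torus M. \<epsilon>\<^sup>2 * (mass (Suc n) \<kappa> - mass n \<kappa>) + micro_rest \<kappa> + 2 * \<tau> * grad \<kappa>) \<le> 0"
  proof -
    have "\<epsilon>\<^sup>2 * (mass (Suc n) \<kappa> - mass n \<kappa>) + micro_rest \<kappa> + 2 * \<tau> * grad \<kappa> \<le> 0" if \<kappa>: "\<kappa> \<in> J" for \<kappa>
    proof -
      have \<kappa>': "\<kappa> \<in> interfaces" "\<kappa> \<in> unknowns b N" "\<kappa> \<in> interfaces \<inter> unknowns b N"
        using \<kappa> by (auto simp: J_def)
      have up: "upwind \<Delta> \<Omega> v (G n) \<kappa> = upwind \<Delta> \<Omega> v (g n) \<kappa>" for v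
        unfolding G_def
        by (intro upwind_torus_ext even_invariant_grids bc_g times grid(2) \<kappa>' staggered_neighbours)
      have ctr: "diff_ctr \<Delta> v (U n) \<kappa> = diff_ctr \<Delta> v (u n) \<kappa>" for v
        unfolding U_def
        by (intro diff_ctr_torus_ext even_invariant_grids bc_u times grid(2) \<kappa>' staggered_neighbours)
      have \<sigma>t: "\<sigma>t0 \<le> \<sigma>t (position lo \<Delta> \<kappa>)"
        by (rule sigma_t_bound(2)[OF position_in_rectangle[OF grid(2,1,3) \<kappa>'(2)]])
      have "\<epsilon>\<^sup>2 * (mass (Suc n) \<kappa> - mass n \<kappa>) + micro_rest \<kappa>
          = (\<Sum>l\<in>UNIV. w $ l * (\<epsilon>\<^sup>2 * ((g (Suc n) \<kappa> $ l)\<^sup>2 - (g n \<kappa> $ l)\<^sup>2 + (g (Suc n) \<kappa> $ l - g n \<kappa> $ l)\<^sup>2)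
            + 2 * \<tau> * \<epsilon> * (g (Suc n) \<kappa> $ l * (upwind \<Delta> \<Omega> Xdir (g n) \<kappa> + upwind \<Delta> \<Omega> Ydir (g n) \<kappa>) $ l)
            + 2 * \<tau> * \<sigma>t0 * (g (Suc n) \<kappa> $ l)\<^sup>2))"
        unfolding mass_def micro_rest_def G_J[OF \<kappa>] up sum_subtractf[symmetric] sum_distrib_left
          sum.distrib[symmetric]
        by (rule sum.cong) (simp_all add: algebra_simps)
      moreover have "grad \<kappa>
          = (\<Sum>v\<in>{Xdir, Ydir}. diff_ctr \<Delta> v (u n) \<kappa> * (w \<bullet> (Q \<Omega> v *v g (Suc n) \<kappa>)))"
        by (simp add: grad_def ctr G_J[OF \<kappa>])
      ultimately show ?thesis
        using micro_balance[OF constants_pos(2,5) quad(1) \<sigma>t zero_mean[OF times(2) \<kappa>'(1)]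
            micro[OF \<kappa>'(3), folded u_def]]
        by (simp only: \<tau>_def)
    qed
    then have "(\<Sum>\<kappa>\<in>J. \<epsilon>\<^sup>2 * (mass (Suc n) \<kappa> - mass n \<kappa>) + micro_rest \<kappa> + 2 * \<tau> * grad \<kappa>) \<le> 0"
      by (rule sum_nonpos)
    then show ?thesis
      by (subst on_J) (simp_all add: G_off mass_def micro_rest_def grad_def)
  qed

  have parts: "(\<Sum>\<kappa>\<in>torus M. grad \<kappa>) = - (\<Sum>\<kappa>\<in>torus M. U n \<kappa> * flux \<kappa>)"
  proof -
    have axis: "(\<Sum>\<kappa>\<in>torus M. diff_ctr \<Delta> v (U n) \<kappa> * (w \<bullet> (Q \<Omega> v *v G (Suc n) \<kappa>)))
        = - (\<Sum>\<kappa>\<in>torus M. U n \<kappa> * (w \<bullet> (Q \<Omega> v *v diff_ctr \<Delta> v (G (Suc n)) \<kappa>)))" for v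
      using sum_by_parts_ctr[OF periodic_apply[OF per(2), of "\<lambda>x. w \<bullet> (Q \<Omega> v *v x)" "Suc n"] per(1),
          of \<Delta> v n]
      unfolding flux_diff_ctr by (simp add: mult.commute)
    show ?thesis
      using axis[of Xdir] axis[of Ydir] by (simp add: grad_def flux_def distrib_left sum.distrib)
  qed

  have cfl: "3 * \<tau> * \<bar>\<Omega> v $ l\<bar> \<le> \<epsilon> * \<Delta> v * \<bar>\<Omega> v $ l\<bar> + \<sigma>t0 * (\<Delta> v)\<^sup>2 / 4" for v l
  proof (cases "\<Omega> v $ l = 0")
    case True
    then show ?thesis using sigma_t_bound(1) by simp
  next
    case False
    then have pos: "\<bar>\<Omega> v $ l\<bar> > 0" by simp
    have "3 * \<tau> \<le> \<epsilon> * \<Delta> v + \<sigma>t0 * (\<Delta> v)\<^sup>2 / (4 * \<bar>\<Omega> v $ l\<bar>)"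
      using mult_left_mono[OF CFL[OF False], of "3 * c"] constants_pos(2) by (simp add: \<tau>_def mult_ac)
    from mult_right_mono[OF this less_imp_le[OF pos]] show ?thesis
      using False by (simp add: distrib_right)
  qed

  have core: "0 \<le> (\<Sum>\<kappa>\<in>torus M. 2 * pi * (U (Suc n) \<kappa> - U n \<kappa>)\<^sup>2
        + 2 * \<tau> * ((U (Suc n) \<kappa> - U n \<kappa>) * flux \<kappa>)) + (\<Sum>\<kappa>\<in>torus M. micro_rest \<kappa>)"
    unfolding flux_def micro_rest_def
    using quad \<tau>_pos sigma_t_bound(1) \<Delta>_pos cfl
    by (intro coupled_dissipation per) (auto simp: less_imp_le)

  \<comment> \<open>The flux is tested with \<open>U (Suc n)\<close>, the gradient cancels the part with \<open>U n\<close>: only the flux against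
    the increment survives, which is the term in \<open>core\<close>.\<close>
  have scaled: "2 * pi * (\<Sum>\<kappa>\<in>torus M. (U (Suc n) \<kappa>)\<^sup>2 - (U n \<kappa>)\<^sup>2)
      + \<epsilon>\<^sup>2 * (\<Sum>\<kappa>\<in>torus M. mass (Suc n) \<kappa> - mass n \<kappa>)
      + 2 / 5 * \<theta> * (\<Sum>\<kappa>\<in>A. T (Suc n) \<kappa> ^ 5 - T n \<kappa> ^ 5) \<le> 0"
  proof -
    have "(\<Sum>\<kappa>\<in>torus M. 2 * pi * ((U (Suc n) \<kappa>)\<^sup>2 - (U n \<kappa>)\<^sup>2 + (U (Suc n) \<kappa> - U n \<kappa>)\<^sup>2)
        + 2 * \<tau> * (U (Suc n) \<kappa> * flux \<kappa>))
      = 2 * pi * (\<Sum>\<kappa>\<in>torus M. (U (Suc n) \<kappa>)\<^sup>2 - (U n \<kappa>)\<^sup>2)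
        + (\<Sum>\<kappa>\<in>torus M. 2 * pi * (U (Suc n) \<kappa> - U n \<kappa>)\<^sup>2
            + 2 * \<tau> * ((U (Suc n) \<kappa> - U n \<kappa>) * flux \<kappa>))
        + 2 * \<tau> * (\<Sum>\<kappa>\<in>torus M. U n \<kappa> * flux \<kappa>)"
      unfolding sum_distrib_left sum.distrib[symmetric]
      by (rule sum.cong) (simp_all add: algebra_simps)
    moreover have "(\<Sum>\<kappa>\<in>torus M. \<epsilon>\<^sup>2 * (mass (Suc n) \<kappa> - mass n \<kappa>) + micro_rest \<kappa> + 2 * \<tau> * grad \<kappa>)
        = \<epsilon>\<^sup>2 * (\<Sum>\<kappa>\<in>torus M. mass (Suc n) \<kappa> - mass n \<kappa>) + (\<Sum>\<kappa>\<in>torus M. micro_rest \<kappa>)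
          - 2 * \<tau> * (\<Sum>\<kappa>\<in>torus M. U n \<kappa> * flux \<kappa>)"
      unfolding sum.distrib sum_distrib_left[symmetric] parts by simp
    ultimately show ?thesis
      using macro_sum micro_sum core by linarith
  qed

  define E where "E m = 2 * pi * (\<Sum>\<kappa>\<in>A. (u m \<kappa>)\<^sup>2)
      + \<epsilon>\<^sup>2 * (\<Sum>\<kappa>\<in>J. \<Sum>l\<in>UNIV. w $ l * (g m \<kappa> $ l)\<^sup>2) + 2 / 5 * \<theta> * (\<Sum>\<kappa>\<in>A. T m \<kappa> ^ 5)" for m
  have sum_U: "(\<Sum>\<kappa>\<in>torus M. (U m \<kappa>)\<^sup>2) = (\<Sum>\<kappa>\<in>A. (u m \<kappa>)\<^sup>2)" for m
    by (subst on_A) (simp_all add: U_off U_A)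
  have sum_G: "(\<Sum>\<kappa>\<in>torus M. mass m \<kappa>) = (\<Sum>\<kappa>\<in>J. \<Sum>l\<in>UNIV. w $ l * (g m \<kappa> $ l)\<^sup>2)" for m
    unfolding mass_def by (subst on_J) (simp_all add: G_off G_J)
  have decay: "E (Suc n) \<le> E n"
    using scaled unfolding E_def sum_subtractf sum_U sum_G right_diff_distrib by linarith
  have energy: "energy \<epsilon> c a c\<^sub>\<nu> \<Delta> (unknowns b N) w (g m) (h m) (T m)
      = \<Delta> Xdir * \<Delta> Ydir / (2 * pi * c\<^sup>2) * E m" if "m \<in> {n, Suc n}" for m
    unfolding E_def u_def A_def J_def \<theta>_def B_def
    by (rule energy_eq_scaled_sum[OF constants_pos(2,3,4) T_nonneg[OF that]])
  show ?thesis
    unfolding energy[OF times(1)] energy[OF times(2)]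
    by (rule mult_left_mono[OF decay]) (simp add: \<Delta>_pos less_imp_le)
qed

end
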